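(* Let $\mathbb{K}$ be $\mathbb{R}$ or $\mathbb{C}$. Then the right singular ideals satisfy $Z_r(\overline{\mathbb{K}})=0$ and $Z_r(\overline{\mathbb{H}})=0$, and the maximal ring of quotients $Q_{max}(\overline{\mathbb{K}})$ and the maximal right ring of quotients $Q_{mr}(\overline{\mathbb{H}})$ are von Neumann regular.
   Context: Let $\mathbf{I}=\,]0,1]$. A function $\hat x:\mathbf{I}\to\mathbb{K}$ is moderate if there is $a\in\mathbb{R}$ with $\lim_{\varepsilon\to 0}|\hat x(\varepsilon)|/\varepsilon^{a}=0$, and null if this limit is $0$ for all $a\in\mathbb{R}$. The moderate functions form a ring under pointwise operations, the null functions form an ideal in it, and $\overline{\mathbb{K}}$ (Colombeau generalized numbers) is the quotient ring. $\overline{\mathbb{H}}=\mathbb{H}(\overline{\mathbb{R}})=\overline{\mathbb{R}}+\overline{\mathbb{R}}i+\overline{\mathbb{R}}j+\overline{\mathbb{R}}k$ is the quaternion algebra over $\overline{\mathbb{R}}$ (with the usual relations $i^2=j^2=k^2=ijk=-1$). For a ring $R$, $Z_r(R)$ is the right singular ideal, i.e. the set of $x\in R$ whose right annihilator $\{y\in R: xy=0\}$ is an essential right ideal. $Q_{mr}(R)$ is the maximal (Utumi) right ring of quotients of $R$; for commutative $R$ it is denoted $Q_{max}(R)$. *)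

theory Defs
  imports Complex_Main "HOL-Algebra.QuotRing"
begin

section \<open>Colombeau generalized numbers\<close>

abbreviation param_interval :: "real set" where
  "param_interval \<equiv> {0<..1}"

definition moderate :: "(real \<Rightarrow> 'a::real_normed_field) \<Rightarrow> bool" where
  "moderate x \<longleftrightarrow>
     (\<exists>a::real. ((\<lambda>e. norm (x e) / e powr a) \<longlongrightarrow> 0) (at 0 within param_interval))"

definition null_fun :: "(real \<Rightarrow> 'a::real_normed_field) \<Rightarrow> bool" where
  "null_fun x \<longleftrightarrow>
     (\<forall>a::real. ((\<lambda>e. norm (x e) / e powr a) \<longlongrightarrow> 0) (at 0 within param_interval))"

text \<open>Functions on \<open>]0,1]\<close> are represented by extensional functions on the reals, i.e.
  functions with value \<open>undefined\<close> outside \<open>]0,1]\<close>.\<close>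

definition moderate_ring :: "(real \<Rightarrow> 'a::real_normed_field) ring" where
  "moderate_ring =
     \<lparr> carrier = {x \<in> extensional param_interval. moderate x},
       mult = (\<lambda>x y. \<lambda>e\<in>param_interval. x e * y e),
       one = (\<lambda>e\<in>param_interval. 1),
       zero = (\<lambda>e\<in>param_interval. 0),
       add = (\<lambda>x y. \<lambda>e\<in>param_interval. x e + y e) \<rparr>"

definition null_ideal :: "(real \<Rightarrow> 'a::real_normed_field) set" where
  "null_ideal = {x \<in> extensional param_interval. null_fun x}"

definition colombeau :: "(real \<Rightarrow> 'a::real_normed_field) set ring" where
  "colombeau = moderate_ring Quot null_ideal"

abbreviation colombeau_real :: "(real \<Rightarrow> real) set ring" where
  "colombeau_real \<equiv> colombeau"

abbreviation colombeau_complex :: "(real \<Rightarrow> complex) set ring" where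
  "colombeau_complex \<equiv> colombeau"


section \<open>Quaternions over a commutative ring\<close>

text \<open>The quadruple \<open>(a, b, c, d)\<close> stands for \<open>a + b i + c j + d k\<close>.\<close>

definition quaternion_ring ::
    "('a, 'm) ring_scheme \<Rightarrow> ('a \<times> 'a \<times> 'a \<times> 'a) ring" where
  "quaternion_ring R =
     \<lparr> carrier = carrier R \<times> carrier R \<times> carrier R \<times> carrier R,
       mult = (\<lambda>(a, b, c, d) (a', b', c', d').
         (a \<otimes>\<^bsub>R\<^esub> a' \<ominus>\<^bsub>R\<^esub> b \<otimes>\<^bsub>R\<^esub> b' \<ominus>\<^bsub>R\<^esub> c \<otimes>\<^bsub>R\<^esub> c' \<ominus>\<^bsub>R\<^esub> d \<otimes>\<^bsub>R\<^esub> d',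
          a \<otimes>\<^bsub>R\<^esub> b' \<oplus>\<^bsub>R\<^esub> b \<otimes>\<^bsub>R\<^esub> a' \<oplus>\<^bsub>R\<^esub> c \<otimes>\<^bsub>R\<^esub> d' \<ominus>\<^bsub>R\<^esub> d \<otimes>\<^bsub>R\<^esub> c',
          a \<otimes>\<^bsub>R\<^esub> c' \<ominus>\<^bsub>R\<^esub> b \<otimes>\<^bsub>R\<^esub> d' \<oplus>\<^bsub>R\<^esub> c \<otimes>\<^bsub>R\<^esub> a' \<oplus>\<^bsub>R\<^esub> d \<otimes>\<^bsub>R\<^esub> b',
          a \<otimes>\<^bsub>R\<^esub> d' \<oplus>\<^bsub>R\<^esub> b \<otimes>\<^bsub>R\<^esub> c' \<ominus>\<^bsub>R\<^esub> c \<otimes>\<^bsub>R\<^esub> b' \<oplus>\<^bsub>R\<^esub> d \<otimes>\<^bsub>R\<^esub> a')),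
       one = (\<one>\<^bsub>R\<^esub>, \<zero>\<^bsub>R\<^esub>, \<zero>\<^bsub>R\<^esub>, \<zero>\<^bsub>R\<^esub>),
       zero = (\<zero>\<^bsub>R\<^esub>, \<zero>\<^bsub>R\<^esub>, \<zero>\<^bsub>R\<^esub>, \<zero>\<^bsub>R\<^esub>),
       add = (\<lambda>(a, b, c, d) (a', b', c', d').
         (a \<oplus>\<^bsub>R\<^esub> a', b \<oplus>\<^bsub>R\<^esub> b', c \<oplus>\<^bsub>R\<^esub> c', d \<oplus>\<^bsub>R\<^esub> d')) \<rparr>"

abbreviation colombeau_quaternions ::
    "((real \<Rightarrow> real) set \<times> (real \<Rightarrow> real) set \<times> (real \<Rightarrow> real) set \<times> (real \<Rightarrow> real) set) ring" where
  "colombeau_quaternions \<equiv> quaternion_ring colombeau_real"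


section \<open>The right singular ideal\<close>

locale right_ideal = ring R + additive_subgroup I R
  for I and R (structure) +
  assumes I_r_closed: "\<lbrakk>a \<in> I; r \<in> carrier R\<rbrakk> \<Longrightarrow> a \<otimes> r \<in> I"

definition essential_right_ideal :: "'a set \<Rightarrow> ('a, 'm) ring_scheme \<Rightarrow> bool" where
  "essential_right_ideal I R \<longleftrightarrow> right_ideal I R \<and>
     (\<forall>J. right_ideal J R \<and> J \<noteq> {\<zero>\<^bsub>R\<^esub>} \<longrightarrow> I \<inter> J \<noteq> {\<zero>\<^bsub>R\<^esub>})"

definition right_annihilator :: "('a, 'm) ring_scheme \<Rightarrow> 'a \<Rightarrow> 'a set" where
  "right_annihilator R x = {y \<in> carrier R. x \<otimes>\<^bsub>R\<^esub> y = \<zero>\<^bsub>R\<^esub>}"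

definition Z_r :: "('a, 'm) ring_scheme \<Rightarrow> 'a set" where
  "Z_r R = {x \<in> carrier R. essential_right_ideal (right_annihilator R x) R}"


section \<open>The maximal right ring of quotients\<close>

definition dense_right_ideal :: "'a set \<Rightarrow> ('a, 'm) ring_scheme \<Rightarrow> bool" where
  "dense_right_ideal D R \<longleftrightarrow> right_ideal D R \<and>
     (\<forall>x \<in> carrier R. \<forall>y \<in> carrier R. x \<noteq> \<zero>\<^bsub>R\<^esub> \<longrightarrow>
        (\<exists>r \<in> carrier R. x \<otimes>\<^bsub>R\<^esub> r \<noteq> \<zero>\<^bsub>R\<^esub> \<and> y \<otimes>\<^bsub>R\<^esub> r \<in> D))"

text \<open>Right \<open>R\<close>-module homomorphisms from a right ideal \<open>D\<close> to \<open>R\<close>.\<close>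

definition right_hom :: "'a set \<Rightarrow> ('a, 'm) ring_scheme \<Rightarrow> ('a \<Rightarrow> 'a) set" where
  "right_hom D R = {f \<in> D \<rightarrow>\<^sub>E carrier R.
     (\<forall>x \<in> D. \<forall>y \<in> D. f (x \<oplus>\<^bsub>R\<^esub> y) = f x \<oplus>\<^bsub>R\<^esub> f y) \<and>
     (\<forall>x \<in> D. \<forall>r \<in> carrier R. f (x \<otimes>\<^bsub>R\<^esub> r) = f x \<otimes>\<^bsub>R\<^esub> r)}"

text \<open>Utumi's construction: \<open>Q_mr R\<close> is the direct limit of the groups \<open>Hom(D, R)\<close> over the
  dense right ideals \<open>D\<close>. Its elements are classes of partial homomorphisms \<open>(D, f)\<close>, two of
  which are identified when they agree on a dense right ideal contained in both domains; the
  product is composition, where \<open>f \<circ> g\<close> has domain \<open>g\<^sup>-\<^sup>1(D)\<close> for \<open>D\<close> the domain of \<open>f\<close>.\<close>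

definition partial_homs :: "('a, 'm) ring_scheme \<Rightarrow> ('a set \<times> ('a \<Rightarrow> 'a)) set" where
  "partial_homs R = {(D, f). dense_right_ideal D R \<and> f \<in> right_hom D R}"

definition partial_hom_rel ::
    "('a, 'm) ring_scheme \<Rightarrow> (('a set \<times> ('a \<Rightarrow> 'a)) \<times> ('a set \<times> ('a \<Rightarrow> 'a))) set" where
  "partial_hom_rel R = {((D, f), (E, g)). (D, f) \<in> partial_homs R \<and> (E, g) \<in> partial_homs R \<and>
     (\<exists>L. dense_right_ideal L R \<and> L \<subseteq> D \<inter> E \<and> (\<forall>x \<in> L. f x = g x))}"

fun partial_hom_add :: "('a, 'm) ring_scheme \<Rightarrow>
    'a set \<times> ('a \<Rightarrow> 'a) \<Rightarrow> 'a set \<times> ('a \<Rightarrow> 'a) \<Rightarrow> 'a set \<times> ('a \<Rightarrow> 'a)" where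
  "partial_hom_add R (D, f) (E, g) = (D \<inter> E, \<lambda>x \<in> D \<inter> E. f x \<oplus>\<^bsub>R\<^esub> g x)"

fun partial_hom_mult ::
    "'a set \<times> ('a \<Rightarrow> 'a) \<Rightarrow> 'a set \<times> ('a \<Rightarrow> 'a) \<Rightarrow> 'a set \<times> ('a \<Rightarrow> 'a)" where
  "partial_hom_mult (D, f) (E, g) = ({x \<in> E. g x \<in> D}, \<lambda>x \<in> {x \<in> E. g x \<in> D}. f (g x))"

definition Q_mr :: "('a, 'm) ring_scheme \<Rightarrow> ('a set \<times> ('a \<Rightarrow> 'a)) set ring" where
  "Q_mr R =
     \<lparr> carrier = partial_homs R // partial_hom_rel R,
       mult = (\<lambda>P Q. \<Union>p \<in> P. \<Union>q \<in> Q. partial_hom_rel R `` {partial_hom_mult p q}),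
       one = partial_hom_rel R `` {(carrier R, \<lambda>x \<in> carrier R. x)},
       zero = partial_hom_rel R `` {(carrier R, \<lambda>x \<in> carrier R. \<zero>\<^bsub>R\<^esub>)},
       add = (\<lambda>P Q. \<Union>p \<in> P. \<Union>q \<in> Q. partial_hom_rel R `` {partial_hom_add R p q}) \<rparr>"

abbreviation (input) Q_max :: "('a, 'm) ring_scheme \<Rightarrow> ('a set \<times> ('a \<Rightarrow> 'a)) set ring" where
  "Q_max \<equiv> Q_mr"

locale von_neumann_regular = ring R for R (structure) +
  assumes regular: "a \<in> carrier R \<Longrightarrow> \<exists>x \<in> carrier R. a \<otimes> x \<otimes> a = a"

end

theory Submission
  imports Defs "HOL-Algebra.Multiplicative_Group"
begin

text \<open>
  All three rings are reduced, and a reduced ring \<open>R\<close> is right nonsingular: if the right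
  annihilator of \<open>x \<noteq> 0\<close> were essential, it would contain some \<open>x r \<noteq> 0\<close>, and \<open>x x r = 0\<close>
  forces \<open>x r = 0\<close> (\<open>Z_r_reduced\<close>).  Regularity of \<open>Q_mr R\<close> is then Johnson's theorem
  (\<open>von_neumann_regular_Q_mr\<close>).

  Reducedness of the generalized numbers holds because \<open>|x|\<^sup>2 / \<epsilon>\<^sup>2\<^sup>a \<rightarrow> 0\<close> implies
  \<open>|x| / \<epsilon>\<^sup>a \<rightarrow> 0\<close>.  Over the reals a summand of a sum of squares is bounded by the sum, so a sum
  of squares vanishes only if all its summands do; with this the equation \<open>q\<^sup>2 = 0\<close> can be solved
  coordinatewise in the quaternions (\<open>quaternion_reduced\<close>).

  For Johnson's theorem, nonsingularity makes every essential right ideal dense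
  (\<open>essential_imp_dense\<close>).  Given \<open>f : D \<rightarrow> R\<close>, split off the kernel: there is a right ideal
  \<open>L \<subseteq> D\<close> on which \<open>f\<close> is injective and such that \<open>ker f + L\<close> is essential.  The inverse of
  \<open>f : L \<rightarrow> f(L)\<close>, extended by zero to a complement of \<open>f(L)\<close>, has an essential and hence dense
  domain, and it is a quasi-inverse of \<open>f\<close> on \<open>ker f + L\<close> (\<open>ex_quasi_inverse\<close>).
  That \<open>Q_mr R\<close> is a ring at all (\<open>ring_Q_mr\<close>) holds for every \<open>R\<close>: two partial homomorphisms
  are identified iff they have a common restriction, and both operations respect restriction.
\<close>

section \<open>Right ideals and homomorphisms\<close>

context ring
begin

lemma right_idealI:
  assumes sub: "I \<subseteq> carrier R" and zero: "\<zero> \<in> I"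
    and add: "\<And>x y. \<lbrakk>x \<in> I; y \<in> I\<rbrakk> \<Longrightarrow> x \<oplus> y \<in> I"
    and mult: "\<And>x r. \<lbrakk>x \<in> I; r \<in> carrier R\<rbrakk> \<Longrightarrow> x \<otimes> r \<in> I"
  shows "right_ideal I R"
proof -
  have neg: "\<ominus> x \<in> I" if "x \<in> I" for x
  proof -
    have "x \<otimes> (\<ominus> \<one>) = \<ominus> x"
      using that sub by (metis one_closed r_minus r_one subsetD)
    thus ?thesis
      using mult[OF that, of "\<ominus> \<one>"] by simp
  qed
  have "subgroup I (add_monoid R)"
    by (rule group.subgroupI[OF a_group])
      (use sub zero add neg in \<open>auto simp flip: a_inv_def\<close>)
  then show ?thesis
    unfolding right_ideal_def right_ideal_axioms_def additive_subgroup_def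
    using ring_axioms mult by blast
qed

lemma
  assumes "right_ideal I R"
  shows right_ideal_subset: "I \<subseteq> carrier R"
    and right_ideal_zero: "\<zero> \<in> I"
    and right_ideal_add: "\<lbrakk>x \<in> I; y \<in> I\<rbrakk> \<Longrightarrow> x \<oplus> y \<in> I"
    and right_ideal_neg: "x \<in> I \<Longrightarrow> \<ominus> x \<in> I"
    and right_ideal_diff: "\<lbrakk>x \<in> I; y \<in> I\<rbrakk> \<Longrightarrow> x \<ominus> y \<in> I"
    and right_ideal_mult: "\<lbrakk>x \<in> I; r \<in> carrier R\<rbrakk> \<Longrightarrow> x \<otimes> r \<in> I"
proof -
  interpret right_ideal I R by (rule assms)
  show "I \<subseteq> carrier R" "\<zero> \<in> I" "\<lbrakk>x \<in> I; y \<in> I\<rbrakk> \<Longrightarrow> x \<oplus> y \<in> I"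
    "\<lbrakk>x \<in> I; r \<in> carrier R\<rbrakk> \<Longrightarrow> x \<otimes> r \<in> I"
    using a_subset I_r_closed by auto
  show neg: "\<And>x. x \<in> I \<Longrightarrow> \<ominus> x \<in> I"
    by (rule a_inv_closed)
  show "\<lbrakk>x \<in> I; y \<in> I\<rbrakk> \<Longrightarrow> x \<ominus> y \<in> I"
    unfolding a_minus_def using neg by simp
qed

lemma right_ideal_carrier: "right_ideal (carrier R) R"
  by (rule right_idealI) auto

lemma right_ideal_principal:
  assumes "a \<in> carrier R"
  shows "right_ideal {a \<otimes> r | r. r \<in> carrier R} R"
proof (rule right_idealI)
  show "\<zero> \<in> {a \<otimes> r | r. r \<in> carrier R}"
    using assms by (auto intro!: exI[of _ \<zero>])
  show "x \<oplus> y \<in> {a \<otimes> r | r. r \<in> carrier R}"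
    if "x \<in> {a \<otimes> r | r. r \<in> carrier R}" "y \<in> {a \<otimes> r | r. r \<in> carrier R}" for x y
    using that assms by (force simp flip: r_distr)
qed (use assms m_assoc in auto)

lemma right_ideal_Int:
  "\<lbrakk>right_ideal I R; right_ideal J R\<rbrakk> \<Longrightarrow> right_ideal (I \<inter> J) R"
  by (rule right_idealI)
    (use right_ideal_subset right_ideal_zero right_ideal_add right_ideal_mult in auto)

lemma set_addI: "\<lbrakk>a \<in> I; b \<in> J\<rbrakk> \<Longrightarrow> a \<oplus> b \<in> I <+>\<^bsub>R\<^esub> J"
  by (auto simp: set_add_def')

lemma set_addE:
  assumes "x \<in> I <+>\<^bsub>R\<^esub> J"
  obtains a b where "a \<in> I" "b \<in> J" "x = a \<oplus> b"
  using assms by (auto simp: set_add_def')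

lemma right_ideal_set_add:
  assumes "right_ideal I R" "right_ideal J R"
  shows "right_ideal (I <+>\<^bsub>R\<^esub> J) R"
proof (rule right_idealI)
  note sub = subsetD[OF right_ideal_subset[OF assms(1)]] subsetD[OF right_ideal_subset[OF assms(2)]]
  show "I <+>\<^bsub>R\<^esub> J \<subseteq> carrier R"
    using sub by (auto simp: set_add_def')
  show "\<zero> \<in> I <+>\<^bsub>R\<^esub> J"
    using assms[THEN right_ideal_zero] by (force simp: set_add_def')
  show "x \<oplus> y \<in> I <+>\<^bsub>R\<^esub> J" if xy: "x \<in> I <+>\<^bsub>R\<^esub> J" "y \<in> I <+>\<^bsub>R\<^esub> J" for x y
  proof -
    obtain a b c d where "a \<in> I" "b \<in> J" "c \<in> I" "d \<in> J" "x = a \<oplus> b" "y = c \<oplus> d"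
      using xy by (auto simp: set_add_def')
    moreover from this have "x \<oplus> y = (a \<oplus> c) \<oplus> (b \<oplus> d)"
      using sub by (simp add: a_ac)
    ultimately show ?thesis
      using assms[THEN right_ideal_add] by (metis set_addI)
  qed
  show "x \<otimes> r \<in> I <+>\<^bsub>R\<^esub> J" if xr: "x \<in> I <+>\<^bsub>R\<^esub> J" "r \<in> carrier R" for x r
  proof -
    obtain a b where "a \<in> I" "b \<in> J" "x = a \<oplus> b"
      using xr by (auto simp: set_add_def')
    moreover from this have "x \<otimes> r = a \<otimes> r \<oplus> b \<otimes> r"
      using sub xr by (simp add: l_distr)
    ultimately show ?thesis
      using assms[THEN right_ideal_mult] xr by (metis set_addI)
  qed
qed

lemma set_add_superset:
  assumes I: "right_ideal I R" and J: "right_ideal J R"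
  shows "I \<subseteq> I <+>\<^bsub>R\<^esub> J" "J \<subseteq> I <+>\<^bsub>R\<^esub> J"
proof
  show "x \<in> I <+>\<^bsub>R\<^esub> J" if "x \<in> I" for x
    using that set_addI[OF that right_ideal_zero[OF J]] right_ideal_subset[OF I] by auto
next
  show "J \<subseteq> I <+>\<^bsub>R\<^esub> J"
  proof
    fix x assume "x \<in> J"
    then show "x \<in> I <+>\<^bsub>R\<^esub> J"
      using set_addI[OF right_ideal_zero[OF I], of x] right_ideal_subset[OF J] by auto
  qed
qed

lemma right_ideal_Union_chain:
  assumes ideals: "\<And>I. I \<in> C \<Longrightarrow> right_ideal I R" and "C \<noteq> {}"
    and chain: "\<And>I J. \<lbrakk>I \<in> C; J \<in> C\<rbrakk> \<Longrightarrow> I \<subseteq> J \<or> J \<subseteq> I"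
  shows "right_ideal (\<Union>C) R"
proof (rule right_idealI)
  show "x \<oplus> y \<in> \<Union>C" if xy: "x \<in> \<Union>C" "y \<in> \<Union>C" for x y
  proof -
    obtain I J where "I \<in> C" "x \<in> I" "J \<in> C" "y \<in> J" using xy by blast
    with chain[of I J] obtain M where "M \<in> C" "x \<in> M" "y \<in> M" by blast
    then show ?thesis using right_ideal_add[OF ideals] by blast
  qed
  show "\<Union>C \<subseteq> carrier R" using right_ideal_subset[OF ideals] by blast
  show "\<zero> \<in> \<Union>C" using right_ideal_zero[OF ideals] \<open>C \<noteq> {}\<close> by blast
  show "x \<otimes> r \<in> \<Union>C" if "x \<in> \<Union>C" "r \<in> carrier R" for x r
    using that right_ideal_mult[OF ideals] by blast
qed

lemma
  assumes "f \<in> right_hom D R"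
  shows right_hom_closed: "x \<in> D \<Longrightarrow> f x \<in> carrier R"
    and right_hom_add: "\<lbrakk>x \<in> D; y \<in> D\<rbrakk> \<Longrightarrow> f (x \<oplus> y) = f x \<oplus> f y"
    and right_hom_mult: "\<lbrakk>x \<in> D; r \<in> carrier R\<rbrakk> \<Longrightarrow> f (x \<otimes> r) = f x \<otimes> r"
  using assms by (auto simp: right_hom_def)

lemma right_hom_restrictI:
  assumes "\<And>x. x \<in> D \<Longrightarrow> f x \<in> carrier R"
    and "\<And>x y. \<lbrakk>x \<in> D; y \<in> D\<rbrakk> \<Longrightarrow> f (x \<oplus> y) = f x \<oplus> f y"
    and "\<And>x r. \<lbrakk>x \<in> D; r \<in> carrier R\<rbrakk> \<Longrightarrow> f (x \<otimes> r) = f x \<otimes> r"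
    and "right_ideal D R"
  shows "restrict f D \<in> right_hom D R"
  using assms right_ideal_add[OF assms(4)] right_ideal_mult[OF assms(4)]
  by (auto simp: right_hom_def)

lemma
  assumes "right_ideal D R" "f \<in> right_hom D R"
  shows right_hom_zero: "f \<zero> = \<zero>"
    and right_hom_diff: "\<lbrakk>x \<in> D; y \<in> D\<rbrakk> \<Longrightarrow> f (x \<ominus> y) = f x \<ominus> f y"
proof -
  note D = assms(1) and f = assms(2)
  show zero: "f \<zero> = \<zero>"
    using right_hom_mult[OF f right_ideal_zero[OF D] zero_closed]
      right_hom_closed[OF f right_ideal_zero[OF D]] by simp
  assume x: "x \<in> D" and y: "y \<in> D"
  have *: "f (\<ominus> y) = \<ominus> f y"
  proof -
    have "y \<otimes> \<ominus> \<one> = \<ominus> y"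
      using y right_ideal_subset[OF D] by (metis one_closed r_minus r_one subsetD)
    thus ?thesis
      using right_hom_mult[OF f y, of "\<ominus> \<one>"] right_hom_closed[OF f y]
      by (metis a_inv_closed one_closed r_minus r_one)
  qed
  then show "f (x \<ominus> y) = f x \<ominus> f y"
    unfolding a_minus_def
    using right_hom_add[OF f x right_ideal_neg[OF D y]] by simp
qed

lemma right_ideal_vimage:
  assumes E: "right_ideal E R" and g: "g \<in> right_hom E R" and D: "right_ideal D R"
  shows "right_ideal {x \<in> E. g x \<in> D} R"
proof (rule right_idealI)
  show "\<zero> \<in> {x \<in> E. g x \<in> D}"
    using right_hom_zero[OF E g] right_ideal_zero[OF D] right_ideal_zero[OF E] by simp
qed (use right_ideal_subset[OF E] right_hom_add[OF g] right_hom_mult[OF g] right_ideal_add[OF E]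
  right_ideal_add[OF D] right_ideal_mult[OF E] right_ideal_mult[OF D] in auto)

lemma right_ideal_image:
  assumes E: "right_ideal E R" and g: "g \<in> right_hom E R" and L: "right_ideal L R" "L \<subseteq> E"
  shows "right_ideal (g ` L) R"
proof (rule right_idealI)
  show "g ` L \<subseteq> carrier R"
    using right_hom_closed[OF g] L by auto
  show "\<zero> \<in> g ` L"
    using right_hom_zero[OF E g] right_ideal_zero[OF L(1)] by force
  show "x \<oplus> y \<in> g ` L" if xy: "x \<in> g ` L" "y \<in> g ` L" for x y
  proof -
    obtain a b where "a \<in> L" "b \<in> L" "x = g a" "y = g b" using xy by auto
    thus ?thesis
      using right_hom_add[OF g, of a b] right_ideal_add[OF L(1), of a b] L(2)
      by (metis image_eqI subsetD)
  qed
  show "x \<otimes> r \<in> g ` L" if xr: "x \<in> g ` L" "r \<in> carrier R" for x r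
  proof -
    obtain a where "a \<in> L" "x = g a" using xr by auto
    thus ?thesis
      using right_hom_mult[OF g, of a r] right_ideal_mult[OF L(1), of a r] L(2) xr
      by (metis image_eqI subsetD)
  qed
qed

lemma right_hom_left_mult:
  assumes "y \<in> carrier R"
  shows "(\<lambda>x\<in>carrier R. y \<otimes> x) \<in> right_hom (carrier R) R"
  by (rule right_hom_restrictI) (use assms r_distr m_assoc right_ideal_carrier in auto)

section \<open>Essential right ideals\<close>

lemma essential_right_idealD:
  assumes "essential_right_ideal I R" "right_ideal J R" "J \<noteq> {\<zero>}"
  obtains x where "x \<in> I" "x \<in> J" "x \<noteq> \<zero>"
proof -
  have "I \<inter> J \<noteq> {\<zero>}" and "right_ideal I R"
    using assms unfolding essential_right_ideal_def by blast+
  then show ?thesis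
    using that right_ideal_zero[of I] right_ideal_zero[OF assms(2)] by blast
qed

lemma essential_right_idealI:
  assumes "right_ideal I R"
    and "\<And>J. \<lbrakk>right_ideal J R; J \<noteq> {\<zero>}\<rbrakk> \<Longrightarrow> \<exists>x\<in>I \<inter> J. x \<noteq> \<zero>"
  shows "essential_right_ideal I R"
  using assms unfolding essential_right_ideal_def by blast

text \<open>Zorn's lemma yields \<open>L\<close> maximal among the right ideals meeting \<open>K\<close> trivially.  A right
  ideal \<open>J\<close> meeting \<open>K + L\<close> trivially could be added to \<open>L\<close>, so it lies in \<open>L\<close> and is zero.\<close>

lemma ex_complement:
  assumes K: "right_ideal K R"
  obtains L where "right_ideal L R" "K \<inter> L = {\<zero>}" "essential_right_ideal (K <+>\<^bsub>R\<^esub> L) R"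
proof -
  define A where "A = {L. right_ideal L R \<and> K \<inter> L = {\<zero>}}"
  have "\<exists>M\<in>A. \<forall>X\<in>A. M \<subseteq> X \<longrightarrow> X = M"
  proof (rule subset_Zorn_nonempty)
    have "{\<zero>} \<in> A"
      unfolding A_def using right_ideal_zero[OF K] by (auto intro!: right_idealI)
    then show "A \<noteq> {}" by blast
    fix C assume "C \<noteq> {}" and C: "subset.chain A C"
    have "right_ideal (\<Union>C) R"
    proof (rule right_ideal_Union_chain[OF _ \<open>C \<noteq> {}\<close>])
      show "\<And>I. I \<in> C \<Longrightarrow> right_ideal I R"
        using C unfolding subset_chain_def A_def by blast
      show "\<And>I J. I \<in> C \<Longrightarrow> J \<in> C \<Longrightarrow> I \<subseteq> J \<or> J \<subseteq> I"
        using C unfolding subset_chain_def by blast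
    qed
    moreover have "K \<inter> \<Union>C = {\<zero>}"
      using C \<open>C \<noteq> {}\<close> unfolding subset_chain_def A_def by blast
    ultimately show "\<Union>C \<in> A" unfolding A_def by blast
  qed
  then obtain L where LA: "L \<in> A" and LA_max: "\<forall>X\<in>A. L \<subseteq> X \<longrightarrow> X = L"
    by blast
  have L: "right_ideal L R" "K \<inter> L = {\<zero>}"
    using LA by (simp_all add: A_def)
  have max: "X = L" if "right_ideal X R" "K \<inter> X = {\<zero>}" "L \<subseteq> X" for X
    using LA_max that by (simp add: A_def)
  note sub = subsetD[OF right_ideal_subset[OF K]] subsetD[OF right_ideal_subset[OF L(1)]]
  have "essential_right_ideal (K <+>\<^bsub>R\<^esub> L) R"
  proof (rule essential_right_idealI[OF right_ideal_set_add[OF K L(1)]])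
    fix J assume J: "right_ideal J R" "J \<noteq> {\<zero>}"
    note subJ = subsetD[OF right_ideal_subset[OF J(1)]]
    show "\<exists>x\<in>(K <+>\<^bsub>R\<^esub> L) \<inter> J. x \<noteq> \<zero>"
    proof (rule ccontr)
      assume "\<not> ?thesis"
      then have triv: "\<And>x. \<lbrakk>x \<in> K <+>\<^bsub>R\<^esub> L; x \<in> J\<rbrakk> \<Longrightarrow> x = \<zero>" by blast
      note le = set_add_superset[OF L(1) J(1)]
      have "x = \<zero>" if x: "x \<in> K" "x \<in> L <+>\<^bsub>R\<^esub> J" for x
      proof -
        obtain l j where lj: "l \<in> L" "j \<in> J" "x = l \<oplus> j"
          using x(2) by (rule set_addE)
        then have "j = x \<oplus> \<ominus> l"
          using x(1) sub subJ by (simp add: a_ac r_neg)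
        then have "j \<in> K <+>\<^bsub>R\<^esub> L"
          using set_addI[OF x(1) right_ideal_neg[OF L(1) lj(1)]] by simp
        with triv lj have "j = \<zero>" by blast
        with lj x have "x \<in> K \<inter> L" using sub by simp
        with L show ?thesis by blast
      qed
      then have "K \<inter> (L <+>\<^bsub>R\<^esub> J) = {\<zero>}"
        using right_ideal_zero[OF K] le(1) right_ideal_zero[OF L(1)] by blast
      then have "L <+>\<^bsub>R\<^esub> J = L"
        using max right_ideal_set_add[OF L(1) J(1)] le by blast
      then have "J \<subseteq> K <+>\<^bsub>R\<^esub> L"
        using le set_add_superset(2)[OF K L(1)] by blast
      then show False
        using triv J right_ideal_zero[OF J(1)] by blast
    qed
  qed
  with L that show thesis by blast
qed

section \<open>Dense right ideals\<close>

lemma dense_right_idealD: "dense_right_ideal D R \<Longrightarrow> right_ideal D R"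
  by (simp add: dense_right_ideal_def)

lemma dense_right_idealE:
  assumes "dense_right_ideal D R" "x \<in> carrier R" "y \<in> carrier R" "x \<noteq> \<zero>"
  obtains r where "r \<in> carrier R" "x \<otimes> r \<noteq> \<zero>" "y \<otimes> r \<in> D"
  using assms unfolding dense_right_ideal_def by blast

lemma dense_right_ideal_carrier: "dense_right_ideal (carrier R) R"
  unfolding dense_right_ideal_def
  using right_ideal_carrier by (metis m_closed one_closed r_one)

text \<open>Density is tested with one multiplier after the other: \<open>r\<close> brings \<open>y\<close> into \<open>E\<close>, then
  \<open>s\<close> brings \<open>g (y r)\<close> into \<open>D\<close>, each keeping the multiple of \<open>x\<close> nonzero.  With \<open>g\<close> an
  inclusion this also gives stability under intersection.\<close>

lemma dense_right_ideal_vimage: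
  assumes E: "dense_right_ideal E R" and g: "g \<in> right_hom E R" and D: "dense_right_ideal D R"
  shows "dense_right_ideal {x \<in> E. g x \<in> D} R"
  unfolding dense_right_ideal_def
proof (intro conjI ballI impI)
  show "right_ideal {x \<in> E. g x \<in> D} R"
    using right_ideal_vimage assms dense_right_idealD by blast
  fix x y assume x: "x \<in> carrier R" "x \<noteq> \<zero>" and y: "y \<in> carrier R"
  obtain r where r: "r \<in> carrier R" "x \<otimes> r \<noteq> \<zero>" "y \<otimes> r \<in> E"
    using dense_right_idealE[OF E x(1) y x(2)] by blast
  obtain s where s: "s \<in> carrier R" "x \<otimes> r \<otimes> s \<noteq> \<zero>" "g (y \<otimes> r) \<otimes> s \<in> D"
    using dense_right_idealE[OF D m_closed[OF x(1) r(1)] right_hom_closed[OF g r(3)] r(2)] by blast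
  have "y \<otimes> r \<otimes> s \<in> E" "g (y \<otimes> r \<otimes> s) \<in> D"
    using right_ideal_mult[OF dense_right_idealD[OF E]] right_hom_mult[OF g] r s by auto
  then show "\<exists>r\<in>carrier R. x \<otimes> r \<noteq> \<zero> \<and> y \<otimes> r \<in> {x \<in> E. g x \<in> D}"
    using r s x y by (intro bexI[of _ "r \<otimes> s"]) (simp_all add: m_assoc)
qed

lemma dense_right_ideal_Int:
  assumes D: "dense_right_ideal D R" and E: "dense_right_ideal E R"
  shows "dense_right_ideal (D \<inter> E) R"
proof -
  have "(\<lambda>x\<in>D. x) \<in> right_hom D R"
    by (rule right_hom_restrictI)
      (use right_ideal_subset[OF dense_right_idealD[OF D]] dense_right_idealD[OF D] in auto)
  from dense_right_ideal_vimage[OF D this E]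
  show ?thesis
    by (auto simp: Int_def elim!: back_subst[of "\<lambda>D. dense_right_ideal D R"])
qed

text \<open>For \<open>x \<noteq> 0\<close> and any \<open>y\<close>, the right ideal of all \<open>r\<close> with \<open>y r \<in> D\<close> is again
  essential.  It therefore cannot annihilate \<open>x\<close>, as otherwise \<open>x\<close> would be singular.\<close>

lemma essential_imp_dense:
  assumes Z: "Z_r R \<subseteq> {\<zero>}" and ess: "essential_right_ideal D R"
  shows "dense_right_ideal D R"
proof -
  have D: "right_ideal D R"
    using ess by (simp add: essential_right_ideal_def)
  have "\<exists>r\<in>carrier R. x \<otimes> r \<noteq> \<zero> \<and> y \<otimes> r \<in> D"
    if x: "x \<in> carrier R" "x \<noteq> \<zero>" and y: "y \<in> carrier R" for x y
  proof (rule ccontr)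
    assume neg: "\<not> ?thesis"
    have ann: "right_ideal (right_annihilator R x) R"
      by (rule right_idealI) (use x in \<open>auto simp: right_annihilator_def r_distr simp flip: m_assoc\<close>)
    have "essential_right_ideal (right_annihilator R x) R"
    proof (rule essential_right_idealI[OF ann])
      fix J assume J: "right_ideal J R" "J \<noteq> {\<zero>}"
      note Jc = subsetD[OF right_ideal_subset[OF J(1)]]
      obtain j where j: "j \<in> J" "j \<noteq> \<zero>" "y \<otimes> j \<in> D"
      proof (cases "\<exists>j\<in>J. y \<otimes> j \<noteq> \<zero>")
        case True
        define f where "f = (\<lambda>x\<in>carrier R. y \<otimes> x)"
        have "right_ideal (f ` J) R"
          unfolding f_def using right_ideal_image[OF right_ideal_carrier right_hom_left_mult[OF y] J(1)]
            right_ideal_subset[OF J(1)] by blast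
        moreover have "f ` J \<noteq> {\<zero>}"
          using True Jc by (force simp: f_def)
        ultimately obtain z where "z \<in> D" "z \<in> f ` J" "z \<noteq> \<zero>"
          using essential_right_idealD[OF ess] by blast
        then show thesis
          using that Jc y by (force simp: f_def)
      next
        case False
        obtain j where "j \<in> J" "j \<noteq> \<zero>"
          using J right_ideal_zero[OF J(1)] by blast
        then show thesis
          using False that right_ideal_zero[OF D] by auto
      qed
      then have "x \<otimes> j = \<zero>"
        using neg Jc by blast
      with j Jc show "\<exists>z\<in>right_annihilator R x \<inter> J. z \<noteq> \<zero>"
        unfolding right_annihilator_def by blast
    qed
    then have "x \<in> Z_r R" using x by (simp add: Z_r_def)
    with Z x show False by blast
  qed
  with D show ?thesis
    unfolding dense_right_ideal_def by blast
qed

lemma dense_imp_essential: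
  assumes D: "dense_right_ideal D R"
  shows "essential_right_ideal D R"
proof (rule essential_right_idealI[OF dense_right_idealD[OF D]])
  fix J assume J: "right_ideal J R" "J \<noteq> {\<zero>}"
  then obtain x where x: "x \<in> J" "x \<noteq> \<zero>" "x \<in> carrier R"
    using right_ideal_zero right_ideal_subset by blast
  then obtain r where "r \<in> carrier R" "x \<otimes> r \<noteq> \<zero>" "x \<otimes> r \<in> D"
    using dense_right_idealE[OF D] by metis
  then show "\<exists>x\<in>D \<inter> J. x \<noteq> \<zero>"
    using right_ideal_mult[OF J(1) x(1)] by blast
qed

section \<open>The maximal right ring of quotients is a ring\<close>

text \<open>The restriction order: two partial homomorphisms are identified in \<open>Q_mr R\<close> iff they have a
  common lower bound.\<close>

definition partial_hom_le :: "'a set \<times> ('a \<Rightarrow> 'a) \<Rightarrow> 'a set \<times> ('a \<Rightarrow> 'a) \<Rightarrow> bool" where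
  "partial_hom_le p q \<longleftrightarrow> fst p \<subseteq> fst q \<and> (\<forall>x\<in>fst p. snd p x = snd q x)"

lemma partial_homsD:
  assumes "(D, f) \<in> partial_homs R"
  shows "dense_right_ideal D R" "right_ideal D R" "f \<in> right_hom D R"
  using assms dense_right_idealD by (auto simp: partial_homs_def)

lemma partial_homs_restrict:
  assumes "(D, f) \<in> partial_homs R" "dense_right_ideal L R" "L \<subseteq> D"
  shows "(L, restrict f L) \<in> partial_homs R"
proof -
  note f = partial_homsD(3)[OF assms(1)]
  have LD: "x \<in> D" if "x \<in> L" for x using that assms(3) by blast
  have "restrict f L \<in> right_hom L R"
    by (rule right_hom_restrictI)
      (use right_hom_closed[OF f] right_hom_add[OF f] right_hom_mult[OF f]
        dense_right_idealD[OF assms(2)] LD in auto)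
  with assms(2) show ?thesis by (simp add: partial_homs_def)
qed

lemma partial_hom_rel_iff:
  "(p, q) \<in> partial_hom_rel R \<longleftrightarrow> p \<in> partial_homs R \<and> q \<in> partial_homs R \<and>
     (\<exists>r\<in>partial_homs R. partial_hom_le r p \<and> partial_hom_le r q)"
proof -
  obtain D f E g where pq: "p = (D, f)" "q = (E, g)" by fastforce
  have "(\<exists>L. dense_right_ideal L R \<and> L \<subseteq> D \<inter> E \<and> (\<forall>x\<in>L. f x = g x)) \<longleftrightarrow>
      (\<exists>r\<in>partial_homs R. partial_hom_le r p \<and> partial_hom_le r q)" if "p \<in> partial_homs R"
  proof
    assume "\<exists>L. dense_right_ideal L R \<and> L \<subseteq> D \<inter> E \<and> (\<forall>x\<in>L. f x = g x)"
    then obtain L where "dense_right_ideal L R" "L \<subseteq> D \<inter> E" "\<forall>x\<in>L. f x = g x" by blast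
    with that show "\<exists>r\<in>partial_homs R. partial_hom_le r p \<and> partial_hom_le r q"
      by (intro bexI[of _ "(L, restrict f L)"])
        (auto simp: partial_hom_le_def pq intro: partial_homs_restrict)
  next
    assume "\<exists>r\<in>partial_homs R. partial_hom_le r p \<and> partial_hom_le r q"
    then obtain L h where r: "(L, h) \<in> partial_homs R" "partial_hom_le (L, h) p"
      "partial_hom_le (L, h) q" by auto
    then have "L \<subseteq> D \<inter> E" "\<forall>x\<in>L. f x = g x"
      by (auto simp: partial_hom_le_def pq)
    with partial_homsD(1)[OF r(1)]
    show "\<exists>L. dense_right_ideal L R \<and> L \<subseteq> D \<inter> E \<and> (\<forall>x\<in>L. f x = g x)" by blast
  qed
  then show ?thesis
    by (auto simp: partial_hom_rel_def pq)
qed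

text \<open>For transitivity, the two common restrictions are restricted once more to the intersection
  of their domains.\<close>

lemma equiv_partial_hom_rel: "equiv (partial_homs R) (partial_hom_rel R)"
proof (rule equivI)
  show "partial_hom_rel R \<subseteq> partial_homs R \<times> partial_homs R"
    by (auto simp: partial_hom_rel_iff)
  show "refl_on (partial_homs R) (partial_hom_rel R)"
    by (rule refl_onI) (auto simp: partial_hom_rel_iff partial_hom_le_def)
  show "sym (partial_hom_rel R)"
    by (rule symI) (auto simp: partial_hom_rel_iff)
  show "trans (partial_hom_rel R)"
  proof (rule transI)
    fix p q r assume pq: "(p, q) \<in> partial_hom_rel R" and qr: "(q, r) \<in> partial_hom_rel R"
    obtain L h where h: "(L, h) \<in> partial_homs R" "partial_hom_le (L, h) p" "partial_hom_le (L, h) q"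
      using pq by (auto simp: partial_hom_rel_iff)
    obtain M k where k: "(M, k) \<in> partial_homs R" "partial_hom_le (M, k) q" "partial_hom_le (M, k) r"
      using qr by (auto simp: partial_hom_rel_iff)
    have "(L \<inter> M, restrict h (L \<inter> M)) \<in> partial_homs R"
      using partial_homs_restrict[OF h(1) dense_right_ideal_Int] partial_homsD(1) h(1) k(1) by blast
    moreover have "partial_hom_le (L \<inter> M, restrict h (L \<inter> M)) p"
      "partial_hom_le (L \<inter> M, restrict h (L \<inter> M)) r"
      using h(2,3) k(2,3) by (auto simp: partial_hom_le_def)
    ultimately show "(p, r) \<in> partial_hom_rel R"
      using pq qr unfolding partial_hom_rel_iff by blast
  qed
qed

lemma partial_hom_add_closed:
  assumes "p \<in> partial_homs R" "q \<in> partial_homs R"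
  shows "partial_hom_add R p q \<in> partial_homs R"
proof -
  obtain D f E g where pq: "p = (D, f)" "q = (E, g)" by fastforce
  note f = partial_homsD[OF assms(1)[unfolded pq]] and g = partial_homsD[OF assms(2)[unfolded pq]]
  have dense: "dense_right_ideal (D \<inter> E) R"
    using dense_right_ideal_Int f(1) g(1) .
  have "(\<lambda>x\<in>D \<inter> E. f x \<oplus> g x) \<in> right_hom (D \<inter> E) R"
    by (rule right_hom_restrictI)
      (use right_hom_closed[OF f(3)] right_hom_closed[OF g(3)] right_hom_add[OF f(3)]
        right_hom_add[OF g(3)] right_hom_mult[OF f(3)] right_hom_mult[OF g(3)]
        dense_right_idealD[OF dense] in \<open>auto simp: a_ac l_distr\<close>)
  with dense show ?thesis by (simp add: pq partial_homs_def)
qed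

lemma partial_hom_mult_closed:
  assumes "p \<in> partial_homs R" "q \<in> partial_homs R"
  shows "partial_hom_mult p q \<in> partial_homs R"
proof -
  obtain D f E g where pq: "p = (D, f)" "q = (E, g)" by fastforce
  note f = partial_homsD[OF assms(1)[unfolded pq]] and g = partial_homsD[OF assms(2)[unfolded pq]]
  have dense: "dense_right_ideal {x \<in> E. g x \<in> D} R"
    using dense_right_ideal_vimage[OF g(1,3) f(1)] .
  have "(\<lambda>x\<in>{x \<in> E. g x \<in> D}. f (g x)) \<in> right_hom {x \<in> E. g x \<in> D} R"
    by (rule right_hom_restrictI)
      (use right_hom_closed[OF f(3)] right_hom_add[OF f(3)]
        right_hom_add[OF g(3)] right_hom_mult[OF f(3)] right_hom_mult[OF g(3)]
        dense_right_idealD[OF dense] in auto)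
  with dense show ?thesis by (simp add: pq partial_homs_def)
qed

lemma partial_hom_add_mono:
  "\<lbrakk>partial_hom_le p p'; partial_hom_le q q'\<rbrakk>
    \<Longrightarrow> partial_hom_le (partial_hom_add R p q) (partial_hom_add R p' q')"
  by (cases p; cases q; cases p'; cases q') (auto simp: partial_hom_le_def)

lemma partial_hom_mult_mono:
  "\<lbrakk>partial_hom_le p p'; partial_hom_le q q'\<rbrakk>
    \<Longrightarrow> partial_hom_le (partial_hom_mult p q) (partial_hom_mult p' q')"
  by (cases p; cases q; cases p'; cases q') (auto simp: partial_hom_le_def)

abbreviation partial_hom_class where
  "partial_hom_class p \<equiv> partial_hom_rel R `` {p}"

lemma carrier_Q_mr_E:
  assumes "x \<in> carrier (Q_mr R)"
  obtains p where "p \<in> partial_homs R" "x = partial_hom_class p"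
  using assms by (auto simp: Q_mr_def elim!: quotientE)

lemma partial_hom_class_closed:
  "p \<in> partial_homs R \<Longrightarrow> partial_hom_class p \<in> carrier (Q_mr R)"
  by (simp add: Q_mr_def quotientI)

lemma partial_hom_class_eq:
  assumes "r \<in> partial_homs R" "p \<in> partial_homs R" "q \<in> partial_homs R"
    "partial_hom_le r p" "partial_hom_le r q"
  shows "partial_hom_class p = partial_hom_class q"
  by (rule equiv_class_eq[OF equiv_partial_hom_rel]) (use assms partial_hom_rel_iff in blast)

lemma partial_hom_class_eqI:
  assumes "p \<in> partial_homs R" "q \<in> partial_homs R" "partial_hom_le p q"
  shows "partial_hom_class p = partial_hom_class q"
  by (rule partial_hom_class_eq[OF assms(1,1,2) _ assms(3)]) (simp add: partial_hom_le_def)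

text \<open>An operation that is monotone for restriction sends common restrictions of its arguments to
  a common restriction of its values, so it passes to the classes.\<close>

lemma Q_mr_op_class:
  assumes p: "p \<in> partial_homs R" and q: "q \<in> partial_homs R"
    and closed: "\<And>p q. \<lbrakk>p \<in> partial_homs R; q \<in> partial_homs R\<rbrakk> \<Longrightarrow> op p q \<in> partial_homs R"
    and mono: "\<And>p p' q q'. \<lbrakk>partial_hom_le p p'; partial_hom_le q q'\<rbrakk>
                 \<Longrightarrow> partial_hom_le (op p q) (op p' q')"
  shows "(\<Union>p'\<in>partial_hom_class p. \<Union>q'\<in>partial_hom_class q. partial_hom_class (op p' q'))
           = partial_hom_class (op p q)"
proof (rule UN_equiv_class2[OF equiv_partial_hom_rel equiv_partial_hom_rel _ p q])
  show "congruent2 (partial_hom_rel R) (partial_hom_rel R) (\<lambda>p q. partial_hom_class (op p q))"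
  proof (rule congruent2I')
    fix p p' q q' assume "(p, p') \<in> partial_hom_rel R" "(q, q') \<in> partial_hom_rel R"
    then obtain r s where "r \<in> partial_homs R" "partial_hom_le r p" "partial_hom_le r p'"
      "s \<in> partial_homs R" "partial_hom_le s q" "partial_hom_le s q'"
      and "p \<in> partial_homs R" "p' \<in> partial_homs R" "q \<in> partial_homs R" "q' \<in> partial_homs R"
      unfolding partial_hom_rel_iff by blast
    then show "partial_hom_class (op p q) = partial_hom_class (op p' q')"
      by (intro partial_hom_class_eq[of "op r s"] closed mono)
  qed
qed

lemma Q_mr_add:
  "\<lbrakk>p \<in> partial_homs R; q \<in> partial_homs R\<rbrakk> \<Longrightarrow>
     partial_hom_class p \<oplus>\<^bsub>Q_mr R\<^esub> partial_hom_class q = partial_hom_class (partial_hom_add R p q)"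
  using Q_mr_op_class[OF _ _ partial_hom_add_closed partial_hom_add_mono]
  by (simp add: Q_mr_def)

lemma Q_mr_mult:
  "\<lbrakk>p \<in> partial_homs R; q \<in> partial_homs R\<rbrakk> \<Longrightarrow>
     partial_hom_class p \<otimes>\<^bsub>Q_mr R\<^esub> partial_hom_class q = partial_hom_class (partial_hom_mult p q)"
  using Q_mr_op_class[OF _ _ partial_hom_mult_closed partial_hom_mult_mono]
  by (simp add: Q_mr_def)

lemma partial_homs_zero: "(carrier R, \<lambda>x\<in>carrier R. \<zero>) \<in> partial_homs R"
  using dense_right_ideal_carrier right_ideal_carrier
  by (auto simp: partial_homs_def intro!: right_hom_restrictI)

lemma partial_homs_one: "(carrier R, \<lambda>x\<in>carrier R. x) \<in> partial_homs R"
  using dense_right_ideal_carrier right_ideal_carrier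
  by (auto simp: partial_homs_def intro!: right_hom_restrictI)

lemma partial_homs_neg:
  assumes "(D, f) \<in> partial_homs R"
  shows "(D, \<lambda>x\<in>D. \<ominus> f x) \<in> partial_homs R"
proof -
  note f = partial_homsD[OF assms]
  have "(\<lambda>x\<in>D. \<ominus> f x) \<in> right_hom D R"
    by (rule right_hom_restrictI)
      (use right_hom_closed[OF f(3)] right_hom_add[OF f(3)] right_hom_mult[OF f(3)] f(2)
        in \<open>auto simp: minus_add l_minus\<close>)
  with f(1) show ?thesis by (simp add: partial_homs_def)
qed

lemma Q_mr_zero: "\<zero>\<^bsub>Q_mr R\<^esub> = partial_hom_class (carrier R, \<lambda>x\<in>carrier R. \<zero>)"
  and Q_mr_one: "\<one>\<^bsub>Q_mr R\<^esub> = partial_hom_class (carrier R, \<lambda>x\<in>carrier R. x)"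
  by (simp_all add: Q_mr_def)

text \<open>Each ring axiom holds already for representatives, up to restriction.  Mostly the two
  domains coincide; in \<open>p (q + r) = p q + p r\<close> the left domain can be larger, because
  \<open>q x + r x\<close> may lie in the domain of \<open>p\<close> although neither summand does.\<close>

lemma ring_Q_mr: "ring (Q_mr R)"
proof -
  note closed = partial_hom_add_closed partial_hom_mult_closed
    partial_homs_zero partial_homs_one
  note Q = Q_mr_add Q_mr_mult Q_mr_zero Q_mr_one partial_hom_class_closed closed
  have val: "f x \<in> carrier R" if "(D, f) \<in> partial_homs R" "x \<in> D" for D f x
    using right_hom_closed partial_homsD(3) that by blast
  have sub: "x \<in> carrier R" if "(D, f) \<in> partial_homs R" "x \<in> D" for D f x
    using right_ideal_subset partial_homsD(2) that by blast
  let ?add = "partial_hom_add R" and ?mult = "partial_hom_mult"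
  let ?zero = "(carrier R, \<lambda>x\<in>carrier R. \<zero>)" and ?one = "(carrier R, \<lambda>x\<in>carrier R. x)"
  have reps:
    "partial_hom_le (?add (?add p q) r) (?add p (?add q r))"
    "partial_hom_le (?mult (?mult p q) r) (?mult p (?mult q r))"
    "partial_hom_le (?mult (?add p q) r) (?add (?mult p r) (?mult q r))"
    "partial_hom_le (?add (?mult p q) (?mult p r)) (?mult p (?add q r))"
    "partial_hom_le (?add p q) (?add q p)"
    "partial_hom_le (?add ?zero p) p"
    "partial_hom_le (?mult ?one p) p"
    "partial_hom_le (?mult p ?one) p"
    if pqr: "p \<in> partial_homs R" "q \<in> partial_homs R" "r \<in> partial_homs R" for p q r
  proof -
    obtain D f E g F h where *: "p = (D, f)" "q = (E, g)" "r = (F, h)" by (metis surj_pair)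
    note pqr' = pqr[unfolded *]
    note simps = * partial_hom_le_def val[OF pqr'(1)] val[OF pqr'(2)] val[OF pqr'(3)]
    show
      "partial_hom_le (?add (?add p q) r) (?add p (?add q r))"
      "partial_hom_le (?mult (?mult p q) r) (?mult p (?mult q r))"
      "partial_hom_le (?mult (?add p q) r) (?add (?mult p r) (?mult q r))"
      "partial_hom_le (?add p q) (?add q p)"
      "partial_hom_le (?add ?zero p) p"
      "partial_hom_le (?mult ?one p) p"
      "partial_hom_le (?mult p ?one) p"
      by (auto simp: simps a_ac)
    show "partial_hom_le (?add (?mult p q) (?mult p r)) (?mult p (?add q r))"
      using right_hom_add[OF partial_homsD(3)[OF pqr'(1)]]
        right_ideal_add[OF partial_homsD(2)[OF pqr'(1)]]
      by (auto simp: simps)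
  qed
  have cls: "\<exists>p\<in>partial_homs R. x = partial_hom_class p" if "x \<in> carrier (Q_mr R)" for x
    using carrier_Q_mr_E[OF that] by blast
  have ag: "abelian_group (Q_mr R)"
  proof (rule abelian_groupI)
    fix x y z
    assume "x \<in> carrier (Q_mr R)" "y \<in> carrier (Q_mr R)" "z \<in> carrier (Q_mr R)"
    then obtain p q r where pqr: "p \<in> partial_homs R" "q \<in> partial_homs R" "r \<in> partial_homs R"
      and xyz: "x = partial_hom_class p" "y = partial_hom_class q" "z = partial_hom_class r"
      by (elim carrier_Q_mr_E) (rule that)
    show "x \<oplus>\<^bsub>Q_mr R\<^esub> y \<oplus>\<^bsub>Q_mr R\<^esub> z = x \<oplus>\<^bsub>Q_mr R\<^esub> (y \<oplus>\<^bsub>Q_mr R\<^esub> z)"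
      unfolding xyz using pqr reps by (simp add: Q partial_hom_class_eqI)
  next
    fix x y
    assume "x \<in> carrier (Q_mr R)" "y \<in> carrier (Q_mr R)"
    then obtain p q where pq: "p \<in> partial_homs R" "q \<in> partial_homs R"
      and xy: "x = partial_hom_class p" "y = partial_hom_class q"
      by (elim carrier_Q_mr_E) (rule that)
    show "x \<oplus>\<^bsub>Q_mr R\<^esub> y \<in> carrier (Q_mr R)"
      unfolding xy using pq by (simp add: Q)
    show "x \<oplus>\<^bsub>Q_mr R\<^esub> y = y \<oplus>\<^bsub>Q_mr R\<^esub> x"
      unfolding xy using pq reps(5)[OF pq pq(1)] by (simp add: Q partial_hom_class_eqI)
  next
    show "\<zero>\<^bsub>Q_mr R\<^esub> \<in> carrier (Q_mr R)" by (simp add: Q)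
  next
    fix x assume "x \<in> carrier (Q_mr R)"
    then obtain D f where p: "(D, f) \<in> partial_homs R" and x: "x = partial_hom_class (D, f)"
      using cls by fastforce
    show "\<zero>\<^bsub>Q_mr R\<^esub> \<oplus>\<^bsub>Q_mr R\<^esub> x = x"
      unfolding x using p reps(6)[OF p p p] by (simp add: Q partial_hom_class_eqI del: partial_hom_add.simps)
    have "partial_hom_le (?add (D, \<lambda>x\<in>D. \<ominus> f x) (D, f)) ?zero"
      using sub[OF p] val[OF p] by (auto simp: partial_hom_le_def l_neg)
    then show "\<exists>y\<in>carrier (Q_mr R). y \<oplus>\<^bsub>Q_mr R\<^esub> x = \<zero>\<^bsub>Q_mr R\<^esub>"
      unfolding x using p partial_homs_neg[OF p]
      by (intro bexI[of _ "partial_hom_class (D, \<lambda>x\<in>D. \<ominus> f x)"])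
        (simp_all add: Q partial_hom_class_eqI del: partial_hom_add.simps)
  qed
  have mon: "monoid (Q_mr R)"
  proof (rule monoidI)
    fix x y z
    assume "x \<in> carrier (Q_mr R)" "y \<in> carrier (Q_mr R)" "z \<in> carrier (Q_mr R)"
    then obtain p q r where pqr: "p \<in> partial_homs R" "q \<in> partial_homs R" "r \<in> partial_homs R"
      and xyz: "x = partial_hom_class p" "y = partial_hom_class q" "z = partial_hom_class r"
      by (elim carrier_Q_mr_E) (rule that)
    show "x \<otimes>\<^bsub>Q_mr R\<^esub> y \<otimes>\<^bsub>Q_mr R\<^esub> z = x \<otimes>\<^bsub>Q_mr R\<^esub> (y \<otimes>\<^bsub>Q_mr R\<^esub> z)"
      unfolding xyz using pqr reps by (simp add: Q partial_hom_class_eqI)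
  next
    fix x y
    assume "x \<in> carrier (Q_mr R)" "y \<in> carrier (Q_mr R)"
    then show "x \<otimes>\<^bsub>Q_mr R\<^esub> y \<in> carrier (Q_mr R)"
      using cls[of x] cls[of y] Q by auto
  next
    show "\<one>\<^bsub>Q_mr R\<^esub> \<in> carrier (Q_mr R)" by (simp add: Q)
  next
    fix x assume "x \<in> carrier (Q_mr R)"
    then obtain p where p: "p \<in> partial_homs R" and x: "x = partial_hom_class p"
      using cls by blast
    show "\<one>\<^bsub>Q_mr R\<^esub> \<otimes>\<^bsub>Q_mr R\<^esub> x = x" "x \<otimes>\<^bsub>Q_mr R\<^esub> \<one>\<^bsub>Q_mr R\<^esub> = x"
      unfolding x using p reps(7,8)[OF p p p] by (simp_all add: Q partial_hom_class_eqI)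
  qed
  show ?thesis
  proof (rule ringI[OF ag mon])
    fix x y z
    assume "x \<in> carrier (Q_mr R)" "y \<in> carrier (Q_mr R)" "z \<in> carrier (Q_mr R)"
    then obtain p q r where pqr: "p \<in> partial_homs R" "q \<in> partial_homs R" "r \<in> partial_homs R"
      and xyz: "x = partial_hom_class p" "y = partial_hom_class q" "z = partial_hom_class r"
      by (elim carrier_Q_mr_E) (rule that)
    show "(x \<oplus>\<^bsub>Q_mr R\<^esub> y) \<otimes>\<^bsub>Q_mr R\<^esub> z = x \<otimes>\<^bsub>Q_mr R\<^esub> z \<oplus>\<^bsub>Q_mr R\<^esub> y \<otimes>\<^bsub>Q_mr R\<^esub> z"
      unfolding xyz using pqr reps(3)[OF pqr] by (simp add: Q partial_hom_class_eqI)
    show "z \<otimes>\<^bsub>Q_mr R\<^esub> (x \<oplus>\<^bsub>Q_mr R\<^esub> y) = z \<otimes>\<^bsub>Q_mr R\<^esub> x \<oplus>\<^bsub>Q_mr R\<^esub> z \<otimes>\<^bsub>Q_mr R\<^esub> y"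
      unfolding xyz using pqr reps(4)[OF pqr(3,1,2)]
      by (simp add: Q partial_hom_class_eqI[symmetric])
  qed
qed

section \<open>Regularity of the maximal right ring of quotients\<close>

text \<open>With \<open>K\<close> the kernel of \<open>f\<close>, \<open>L\<close> the part in \<open>D\<close> of a complement of \<open>K\<close>, and \<open>M\<close> a
  complement of \<open>f(L)\<close>, the map \<open>g\<close> sends \<open>f l + m\<close> to \<open>l\<close>.  It is well defined because
  \<open>f(L) \<inter> M = 0\<close> and \<open>f\<close> is injective on \<open>L\<close>.  On \<open>N = K + L\<close> one gets
  \<open>f (g (f (k + l))) = f (g (f l)) = f l = f (k + l)\<close>.\<close>

lemma ex_quasi_inverse:
  assumes Z: "Z_r R \<subseteq> {\<zero>}" and D: "dense_right_ideal D R" and f: "f \<in> right_hom D R"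
  obtains E g N where "dense_right_ideal E R" "g \<in> right_hom E R" "dense_right_ideal N R"
    "\<And>x. x \<in> N \<Longrightarrow> x \<in> D \<and> f x \<in> E \<and> g (f x) \<in> D \<and> f (g (f x)) = f x"
proof -
  note Di = dense_right_idealD[OF D]
  have zero_ideal: "right_ideal {\<zero>} R"
    by (rule right_idealI) auto
  define K where "K = {x \<in> D. f x \<in> {\<zero>}}"
  have K: "right_ideal K R"
    unfolding K_def by (rule right_ideal_vimage[OF Di f zero_ideal])
  obtain C where C: "right_ideal C R" "K \<inter> C = {\<zero>}" "essential_right_ideal (K <+>\<^bsub>R\<^esub> C) R"
    using ex_complement[OF K] .
  define L where "L = C \<inter> D"
  have L: "right_ideal L R" "L \<subseteq> D"
    unfolding L_def using right_ideal_Int[OF C(1) Di] by auto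
  have Dc: "x \<in> carrier R" if "x \<in> D" for x
    using that right_ideal_subset[OF Di] by blast
  have Cc: "x \<in> carrier R" if "x \<in> C" for x
    using that right_ideal_subset[OF C(1)] by blast
  have KD: "x \<in> D" "f x = \<zero>" if "x \<in> K" for x
    using that by (auto simp: K_def)
  have inj: "a = b" if "a \<in> L" "b \<in> L" "f a = f b" for a b
  proof -
    have ab: "a \<in> D" "b \<in> D" using that L by auto
    have "f (a \<ominus> b) = \<zero>"
      using right_hom_diff[OF Di f ab] that right_hom_closed[OF f ab(2)] by (simp add: r_right_minus_eq)
    then have "a \<ominus> b \<in> K"
      using right_ideal_diff[OF Di ab] by (simp add: K_def)
    moreover have "a \<ominus> b \<in> C"
      using right_ideal_diff[OF C(1)] that by (simp add: L_def)
    ultimately have "a \<ominus> b = \<zero>" using C(2) by blast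
    then show ?thesis using ab Dc by (simp add: r_right_minus_eq)
  qed
  have N_ideal: "right_ideal (K <+>\<^bsub>R\<^esub> L) R"
    by (rule right_ideal_set_add[OF K L(1)])
  \<comment> \<open>Modular law: as \<open>K \<subseteq> D\<close>, the ideal \<open>K + (C \<inter> D)\<close> is \<open>(K + C) \<inter> D\<close>, an intersection
    of two essential ideals.\<close>
  have N: "dense_right_ideal (K <+>\<^bsub>R\<^esub> L) R"
  proof (rule essential_imp_dense[OF Z], rule essential_right_idealI[OF N_ideal])
    fix J assume J: "right_ideal J R" "J \<noteq> {\<zero>}"
    obtain x where "x \<in> D" "x \<in> J" "x \<noteq> \<zero>"
      using essential_right_idealD[OF dense_imp_essential[OF D] J] .
    then have "D \<inter> J \<noteq> {\<zero>}" by blast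
    then obtain z where z: "z \<in> K <+>\<^bsub>R\<^esub> C" "z \<in> D" "z \<in> J" "z \<noteq> \<zero>"
      using essential_right_idealD[OF C(3) right_ideal_Int[OF Di J(1)]] by blast
    obtain k c where kc: "k \<in> K" "c \<in> C" "z = k \<oplus> c"
      using z(1) by (rule set_addE)
    have "c = z \<ominus> k"
      using kc KD Dc Cc by (simp add: a_minus_def a_ac r_neg)
    then have "c \<in> L"
      using right_ideal_diff[OF Di z(2) KD(1)[OF kc(1)]] kc by (simp add: L_def)
    then have "z \<in> K <+>\<^bsub>R\<^esub> L"
      using kc set_addI by blast
    with z show "\<exists>x\<in>(K <+>\<^bsub>R\<^esub> L) \<inter> J. x \<noteq> \<zero>" by blast
  qed
  have fL: "right_ideal (f ` L) R"
    by (rule right_ideal_image[OF Di f L])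
  obtain M where M: "right_ideal M R" "f ` L \<inter> M = {\<zero>}"
    "essential_right_ideal (f ` L <+>\<^bsub>R\<^esub> M) R"
    using ex_complement[OF fL] .
  have Mc: "x \<in> carrier R" if "x \<in> M" for x
    using that right_ideal_subset[OF M(1)] by blast
  have Lc: "x \<in> carrier R" "f x \<in> carrier R" if "x \<in> L" for x
    using that right_ideal_subset[OF L(1)] right_hom_closed[OF f] L(2) by auto
  define E where "E = f ` L <+>\<^bsub>R\<^esub> M"
  have E: "dense_right_ideal E R"
    unfolding E_def by (rule essential_imp_dense[OF Z M(3)])
  note Ei = dense_right_idealD[OF E]
  define g where "g y = (THE l. l \<in> L \<and> (\<exists>m\<in>M. y = f l \<oplus> m))" for y
  have g: "g (f l \<oplus> m) = l" if lm: "l \<in> L" "m \<in> M" for l m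
    unfolding g_def
  proof (rule the_equality)
    show "l \<in> L \<and> (\<exists>m'\<in>M. f l \<oplus> m = f l \<oplus> m')" using lm by blast
    fix l' assume "l' \<in> L \<and> (\<exists>m'\<in>M. f l \<oplus> m = f l' \<oplus> m')"
    then obtain m' where l': "l' \<in> L" "m' \<in> M" "f l \<oplus> m = f l' \<oplus> m'" by blast
    have "f l' \<ominus> f l = m \<ominus> m'"
    proof -
      have "f l' \<ominus> f l = (f l' \<oplus> m') \<ominus> m' \<ominus> f l"
        using l' lm Lc Mc by (simp add: a_minus_def a_assoc r_neg2)
      also have "\<dots> = (m \<oplus> f l) \<oplus> (\<ominus> f l \<oplus> \<ominus> m')"
        using l' lm Lc Mc by (simp add: a_minus_def a_assoc a_comm[of "f l" m] a_comm[of "\<ominus> f l"])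
      also have "\<dots> = m \<ominus> m'"
        using l' lm Lc Mc by (simp add: a_minus_def a_assoc r_neg2)
      finally show ?thesis .
    qed
    moreover have "f l' \<ominus> f l \<in> f ` L"
      using right_ideal_diff[OF fL] l' lm by blast
    moreover have "m \<ominus> m' \<in> M"
      using right_ideal_diff[OF M(1)] l' lm by blast
    ultimately have "f l' \<ominus> f l = \<zero>" using M(2) by auto
    then show "l' = l"
      using inj l' lm Lc by (simp add: r_right_minus_eq)
  qed
  have E_E: "\<exists>l\<in>L. \<exists>m\<in>M. y = f l \<oplus> m" if "y \<in> E" for y
    using that unfolding E_def by (auto elim!: set_addE)
  have g_hom: "restrict g E \<in> right_hom E R"
  proof (rule right_hom_restrictI[OF _ _ _ Ei])
    fix x assume "x \<in> E"
    then obtain l m where x: "l \<in> L" "m \<in> M" "x = f l \<oplus> m" using E_E by blast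
    then show "g x \<in> carrier R" using g Lc by simp
    show "g (x \<otimes> r) = g x \<otimes> r" if r: "r \<in> carrier R" for r
    proof -
      have "l \<in> D" using x L by blast
      have "x \<otimes> r = f (l \<otimes> r) \<oplus> m \<otimes> r"
        using x Lc Mc r right_hom_mult[OF f \<open>l \<in> D\<close> r] by (simp add: l_distr)
      then show ?thesis
        using g[OF right_ideal_mult[OF L(1) x(1) r] right_ideal_mult[OF M(1) x(2) r]]
          g[OF x(1,2)] x(3) by simp
    qed
    fix y assume "y \<in> E"
    then obtain l' m' where y: "l' \<in> L" "m' \<in> M" "y = f l' \<oplus> m'" using E_E by blast
    have "l \<in> D" "l' \<in> D" using x y L by blast+
    then have "x \<oplus> y = f (l \<oplus> l') \<oplus> (m \<oplus> m')"
      using x y Lc Mc right_hom_add[OF f] by (simp add: a_ac)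
    then show "g (x \<oplus> y) = g x \<oplus> g y"
      using g[OF right_ideal_add[OF L(1) x(1) y(1)] right_ideal_add[OF M(1) x(2) y(2)]]
        g[OF x(1,2)] g[OF y(1,2)] x(3) y(3) by simp
  qed
  show thesis
  proof (rule that[OF E g_hom N])
    fix x assume "x \<in> K <+>\<^bsub>R\<^esub> L"
    then obtain k l where kl: "k \<in> K" "l \<in> L" "x = k \<oplus> l" by (rule set_addE)
    have l: "l \<in> D" "f l \<in> carrier R" using kl L Lc by auto
    have fx: "f x = f l"
      using kl l right_hom_add[OF f KD(1) l(1)] KD(2) by simp
    have "g (f l) = l"
      using g[OF kl(2) right_ideal_zero[OF M(1)]] l by simp
    moreover have "f l \<in> E"
      unfolding E_def using set_add_superset(1)[OF fL M(1)] kl by blast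
    moreover have "x \<in> D"
      using kl l right_ideal_add[OF Di KD(1)] by blast
    ultimately show "x \<in> D \<and> f x \<in> E \<and> restrict g E (f x) \<in> D \<and> f (restrict g E (f x)) = f x"
      using fx l by simp
  qed
qed

text \<open>Johnson's theorem.  The equation \<open>f g f = f\<close> holds on a dense right ideal only, which is all
  that equality in \<open>Q_mr R\<close> asks for.\<close>

theorem von_neumann_regular_Q_mr:
  assumes Z: "Z_r R \<subseteq> {\<zero>}"
  shows "von_neumann_regular (Q_mr R)"
proof -
  interpret Q: ring "Q_mr R" by (rule ring_Q_mr)
  show ?thesis
  proof
    fix a assume "a \<in> carrier (Q_mr R)"
    then obtain D f where p: "(D, f) \<in> partial_homs R" and a: "a = partial_hom_class (D, f)"
      by (metis carrier_Q_mr_E surj_pair)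
    obtain E g N where g: "dense_right_ideal E R" "g \<in> right_hom E R" and N: "dense_right_ideal N R"
      and eq: "\<And>x. x \<in> N \<Longrightarrow> x \<in> D \<and> f x \<in> E \<and> g (f x) \<in> D \<and> f (g (f x)) = f x"
      using ex_quasi_inverse[OF Z partial_homsD(1,3)[OF p]] by metis
    have q: "(E, g) \<in> partial_homs R" using g by (simp add: partial_homs_def)
    let ?r = "partial_hom_mult (partial_hom_mult (D, f) (E, g)) (D, f)"
    have r: "?r \<in> partial_homs R"
      using p q by (simp add: partial_hom_mult_closed del: partial_hom_mult.simps)
    have "(N, restrict f N) \<in> partial_homs R"
      using partial_homs_restrict[OF p N] eq by blast
    moreover have "partial_hom_le (N, restrict f N) ?r" "partial_hom_le (N, restrict f N) (D, f)"
      using eq by (auto simp: partial_hom_le_def)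
    ultimately have "partial_hom_class ?r = a"
      unfolding a using partial_hom_class_eq r p by blast
    then have "a \<otimes>\<^bsub>Q_mr R\<^esub> partial_hom_class (E, g) \<otimes>\<^bsub>Q_mr R\<^esub> a = a"
      unfolding a using p q by (simp add: Q_mr_mult partial_hom_mult_closed del: partial_hom_mult.simps)
    then show "\<exists>x\<in>carrier (Q_mr R). a \<otimes>\<^bsub>Q_mr R\<^esub> x \<otimes>\<^bsub>Q_mr R\<^esub> a = a"
      using partial_hom_class_closed[OF q] by blast
  qed
qed

section \<open>Reduced rings are nonsingular\<close>

text \<open>From \<open>x (x r) = 0\<close> first \<open>(x r x)\<^sup>2 = 0\<close>, so \<open>x r x = 0\<close>, then \<open>(x r)\<^sup>2 = 0\<close>, so
  \<open>x r = 0\<close>.  Thus the annihilator of \<open>x\<close> meets \<open>x R\<close> trivially.\<close>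

lemma Z_r_reduced:
  assumes reduced: "\<And>x. \<lbrakk>x \<in> carrier R; x \<otimes> x = \<zero>\<rbrakk> \<Longrightarrow> x = \<zero>"
  shows "Z_r R = {\<zero>}"
proof
  show "Z_r R \<subseteq> {\<zero>}"
  proof
    fix x assume "x \<in> Z_r R"
    then have x: "x \<in> carrier R" and ess: "essential_right_ideal (right_annihilator R x) R"
      by (auto simp: Z_r_def)
    let ?J = "{x \<otimes> r | r. r \<in> carrier R}"
    have "?J = {\<zero>}"
    proof (rule ccontr)
      assume "?J \<noteq> {\<zero>}"
      then obtain r where r: "r \<in> carrier R" "x \<otimes> (x \<otimes> r) = \<zero>" "x \<otimes> r \<noteq> \<zero>"
        using essential_right_idealD[OF ess right_ideal_principal[OF x], of thesis]
        unfolding right_annihilator_def by blast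
      have "(x \<otimes> r \<otimes> x) \<otimes> (x \<otimes> r \<otimes> x) = x \<otimes> r \<otimes> (x \<otimes> (x \<otimes> r)) \<otimes> x"
        using x r(1) by (simp add: m_assoc)
      then have "x \<otimes> r \<otimes> x = \<zero>"
        using reduced[of "x \<otimes> r \<otimes> x"] x r(1,2) by simp
      moreover have "(x \<otimes> r) \<otimes> (x \<otimes> r) = x \<otimes> r \<otimes> x \<otimes> r"
        using x r(1) by (simp add: m_assoc)
      ultimately have "(x \<otimes> r) \<otimes> (x \<otimes> r) = \<zero>"
        using r(1) by simp
      then have "x \<otimes> r = \<zero>"
        using reduced[of "x \<otimes> r"] x r(1) by simp
      with r(3) show False ..
    qed
    moreover have "x \<otimes> \<one> \<in> ?J" by blast
    ultimately show "x \<in> {\<zero>}" using x by auto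
  qed
  have "right_annihilator R \<zero> = carrier R"
    by (auto simp: right_annihilator_def)
  then show "{\<zero>} \<subseteq> Z_r R"
    using dense_imp_essential[OF dense_right_ideal_carrier] by (simp add: Z_r_def)
qed

end

section \<open>Quaternions over a commutative ring\<close>

context cring
begin

lemma quaternion_carrier:
  "(a, b, c, d) \<in> carrier (quaternion_ring R) \<longleftrightarrow>
     a \<in> carrier R \<and> b \<in> carrier R \<and> c \<in> carrier R \<and> d \<in> carrier R"
  by (simp add: quaternion_ring_def)

lemma quaternion_zero: "\<zero>\<^bsub>quaternion_ring R\<^esub> = (\<zero>, \<zero>, \<zero>, \<zero>)"
  and quaternion_one: "\<one>\<^bsub>quaternion_ring R\<^esub> = (\<one>, \<zero>, \<zero>, \<zero>)"
  and quaternion_add: "(a, b, c, d) \<oplus>\<^bsub>quaternion_ring R\<^esub> (a', b', c', d') =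
     (a \<oplus> a', b \<oplus> b', c \<oplus> c', d \<oplus> d')"
  and quaternion_mult: "(a, b, c, d) \<otimes>\<^bsub>quaternion_ring R\<^esub> (a', b', c', d') =
     (a \<otimes> a' \<ominus> b \<otimes> b' \<ominus> c \<otimes> c' \<ominus> d \<otimes> d',
      a \<otimes> b' \<oplus> b \<otimes> a' \<oplus> c \<otimes> d' \<ominus> d \<otimes> c',
      a \<otimes> c' \<ominus> b \<otimes> d' \<oplus> c \<otimes> a' \<oplus> d \<otimes> b',
      a \<otimes> d' \<oplus> b \<otimes> c' \<ominus> c \<otimes> b' \<oplus> d \<otimes> a')"
  by (simp_all add: quaternion_ring_def)

lemmas quaternion_simps =
  quaternion_carrier quaternion_zero quaternion_one quaternion_add quaternion_mult

lemma ring_quaternion_ring: "ring (quaternion_ring R)"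
proof -
  let ?H = "quaternion_ring R"
  have ag: "abelian_group ?H"
  proof (rule abelian_groupI)
    fix x assume x: "x \<in> carrier ?H"
    obtain a b c d where *: "x = (a, b, c, d)" by (metis surj_pair)
    show "\<zero>\<^bsub>?H\<^esub> \<oplus>\<^bsub>?H\<^esub> x = x"
      using x by (simp add: * quaternion_simps)
    show "\<exists>y\<in>carrier ?H. y \<oplus>\<^bsub>?H\<^esub> x = \<zero>\<^bsub>?H\<^esub>"
      using x by (intro bexI[of _ "(\<ominus> a, \<ominus> b, \<ominus> c, \<ominus> d)"]) (simp_all add: * quaternion_simps l_neg)
  next
    show "\<zero>\<^bsub>?H\<^esub> \<in> carrier ?H" by (simp add: quaternion_simps)
  next
    fix x y assume xy: "x \<in> carrier ?H" "y \<in> carrier ?H"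
    obtain a b c d a' b' c' d' where *: "x = (a, b, c, d)" "y = (a', b', c', d')" by (metis surj_pair)
    show "x \<oplus>\<^bsub>?H\<^esub> y \<in> carrier ?H" "x \<oplus>\<^bsub>?H\<^esub> y = y \<oplus>\<^bsub>?H\<^esub> x"
      using xy by (simp_all add: * quaternion_simps a_comm)
    fix z assume z: "z \<in> carrier ?H"
    obtain a'' b'' c'' d'' where **: "z = (a'', b'', c'', d'')" by (metis surj_pair)
    show "x \<oplus>\<^bsub>?H\<^esub> y \<oplus>\<^bsub>?H\<^esub> z = x \<oplus>\<^bsub>?H\<^esub> (y \<oplus>\<^bsub>?H\<^esub> z)"
      using xy z by (simp add: * ** quaternion_simps a_assoc)
  qed
  have distr:
    "(x \<oplus>\<^bsub>?H\<^esub> y) \<otimes>\<^bsub>?H\<^esub> z = x \<otimes>\<^bsub>?H\<^esub> z \<oplus>\<^bsub>?H\<^esub> y \<otimes>\<^bsub>?H\<^esub> z"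
    "z \<otimes>\<^bsub>?H\<^esub> (x \<oplus>\<^bsub>?H\<^esub> y) = z \<otimes>\<^bsub>?H\<^esub> x \<oplus>\<^bsub>?H\<^esub> z \<otimes>\<^bsub>?H\<^esub> y"
    if xyz: "x \<in> carrier ?H" "y \<in> carrier ?H" "z \<in> carrier ?H" for x y z
  proof -
    obtain a b c d a' b' c' d' a'' b'' c'' d''
      where *: "x = (a, b, c, d)" "y = (a', b', c', d')" "z = (a'', b'', c'', d'')"
      by (metis surj_pair)
    have c: "a \<in> carrier R" "b \<in> carrier R" "c \<in> carrier R" "d \<in> carrier R"
      "a' \<in> carrier R" "b' \<in> carrier R" "c' \<in> carrier R" "d' \<in> carrier R"
      "a'' \<in> carrier R" "b'' \<in> carrier R" "c'' \<in> carrier R" "d'' \<in> carrier R"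
      using xyz by (simp_all add: * quaternion_simps)
    show "(x \<oplus>\<^bsub>?H\<^esub> y) \<otimes>\<^bsub>?H\<^esub> z = x \<otimes>\<^bsub>?H\<^esub> z \<oplus>\<^bsub>?H\<^esub> y \<otimes>\<^bsub>?H\<^esub> z"
      "z \<otimes>\<^bsub>?H\<^esub> (x \<oplus>\<^bsub>?H\<^esub> y) = z \<otimes>\<^bsub>?H\<^esub> x \<oplus>\<^bsub>?H\<^esub> z \<otimes>\<^bsub>?H\<^esub> y"
      unfolding * quaternion_mult quaternion_add prod.inject
      using c by (simp_all add: a_minus_def l_distr r_distr minus_add a_ac)
  qed
  have closed: "x \<otimes>\<^bsub>?H\<^esub> y \<in> carrier ?H" if "x \<in> carrier ?H" "y \<in> carrier ?H" for x y
    using that by (cases x; cases y) (simp add: quaternion_simps)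
  have mon: "monoid ?H"
  proof (rule monoidI)
    show "\<one>\<^bsub>?H\<^esub> \<in> carrier ?H" by (simp add: quaternion_simps)
  next
    fix x assume x: "x \<in> carrier ?H"
    obtain a b c d where *: "x = (a, b, c, d)" by (metis surj_pair)
    show "\<one>\<^bsub>?H\<^esub> \<otimes>\<^bsub>?H\<^esub> x = x" "x \<otimes>\<^bsub>?H\<^esub> \<one>\<^bsub>?H\<^esub> = x"
      using x by (simp_all add: * quaternion_simps a_minus_def)
  next
    fix x y assume xy: "x \<in> carrier ?H" "y \<in> carrier ?H"
    obtain a b c d a' b' c' d' where *: "x = (a, b, c, d)" "y = (a', b', c', d')" by (metis surj_pair)
    show xy_closed: "x \<otimes>\<^bsub>?H\<^esub> y \<in> carrier ?H"
      using xy by (rule closed)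
    have c: "a \<in> carrier R" "b \<in> carrier R" "c \<in> carrier R" "d \<in> carrier R"
      "a' \<in> carrier R" "b' \<in> carrier R" "c' \<in> carrier R" "d' \<in> carrier R"
      using xy by (simp_all add: * quaternion_simps)
    let ?assoc = "\<lambda>z. x \<otimes>\<^bsub>?H\<^esub> y \<otimes>\<^bsub>?H\<^esub> z = x \<otimes>\<^bsub>?H\<^esub> (y \<otimes>\<^bsub>?H\<^esub> z)"
    have add: "?assoc (u \<oplus>\<^bsub>?H\<^esub> v)"
      if "?assoc u" "?assoc v" "u \<in> carrier ?H" "v \<in> carrier ?H" for u v
      using that xy xy_closed by (simp add: distr(2) closed)
    \<comment> \<open>Both sides are additive in the third factor, so it may be taken to be a multiple of one of
      the units \<open>1, i, j, k\<close>.\<close>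
    have units: "?assoc (s, \<zero>, \<zero>, \<zero>)" "?assoc (\<zero>, s, \<zero>, \<zero>)" "?assoc (\<zero>, \<zero>, s, \<zero>)" "?assoc (\<zero>, \<zero>, \<zero>, s)"
      if "s \<in> carrier R" for s
      using c that
      by (simp_all add: * quaternion_simps a_minus_def l_distr r_distr l_minus r_minus minus_add m_assoc a_ac)
    fix z assume z: "z \<in> carrier ?H"
    obtain p q r s where **: "z = (p, q, r, s)" by (metis surj_pair)
    have pqrs: "p \<in> carrier R" "q \<in> carrier R" "r \<in> carrier R" "s \<in> carrier R"
      using z by (simp_all add: ** quaternion_simps)
    have "z = (p, \<zero>, \<zero>, \<zero>) \<oplus>\<^bsub>?H\<^esub> ((\<zero>, q, \<zero>, \<zero>) \<oplus>\<^bsub>?H\<^esub> ((\<zero>, \<zero>, r, \<zero>) \<oplus>\<^bsub>?H\<^esub> (\<zero>, \<zero>, \<zero>, s)))"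
      using pqrs by (simp add: ** quaternion_add)
    also have "?assoc \<dots>"
      using pqrs by (intro add units) (simp_all add: quaternion_add quaternion_carrier)
    finally show "?assoc z" .
  qed
  show ?thesis
    by (rule ringI[OF ag mon distr])
qed

text \<open>Let \<open>q = a + b i + c j + d k\<close> square to zero.  The imaginary parts of \<open>q\<^sup>2\<close> are \<open>2 a b\<close>,
  \<open>2 a c\<close> and \<open>2 a d\<close>, and \<open>x + x = 0\<close> gives \<open>x\<^sup>2 + x\<^sup>2 = 0\<close> and
  hence \<open>x = 0\<close>; so \<open>a b = a c = a d = 0\<close>.  The real
  part \<open>a\<^sup>2 = b\<^sup>2 + c\<^sup>2 + d\<^sup>2\<close> multiplied by \<open>a\<close> yields \<open>a\<^sup>3 = 0\<close>, hence \<open>a = 0\<close>, and then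
  \<open>b\<^sup>2 + c\<^sup>2 + d\<^sup>2 = 0\<close>.\<close>

lemma quaternion_reduced:
  assumes formally_real: "\<And>a b c d. \<lbrakk>a \<in> carrier R; b \<in> carrier R; c \<in> carrier R; d \<in> carrier R;
      a \<otimes> a \<oplus> b \<otimes> b \<oplus> c \<otimes> c \<oplus> d \<otimes> d = \<zero>\<rbrakk> \<Longrightarrow> a = \<zero>"
    and q: "q \<in> carrier (quaternion_ring R)"
    and sq: "q \<otimes>\<^bsub>quaternion_ring R\<^esub> q = \<zero>\<^bsub>quaternion_ring R\<^esub>"
  shows "q = \<zero>\<^bsub>quaternion_ring R\<^esub>"
proof -
  obtain a b c d where *: "q = (a, b, c, d)" by (metis surj_pair)
  have car: "a \<in> carrier R" "b \<in> carrier R" "c \<in> carrier R" "d \<in> carrier R"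
    using q by (simp_all add: * quaternion_simps)
  have eq: "a \<otimes> a \<ominus> b \<otimes> b \<ominus> c \<otimes> c \<ominus> d \<otimes> d = \<zero>"
    "a \<otimes> b \<oplus> b \<otimes> a \<oplus> c \<otimes> d \<ominus> d \<otimes> c = \<zero>"
    "a \<otimes> c \<ominus> b \<otimes> d \<oplus> c \<otimes> a \<oplus> d \<otimes> b = \<zero>"
    "a \<otimes> d \<oplus> b \<otimes> c \<ominus> c \<otimes> b \<oplus> d \<otimes> a = \<zero>"
    using sq by (simp_all add: * quaternion_simps)
  have sq0: "x = \<zero>" if "x \<in> carrier R" "x \<otimes> x = \<zero>" for x
    using formally_real[of x \<zero> \<zero> \<zero>] that by simp
  have two0: "x = \<zero>" if "x \<in> carrier R" "x \<oplus> x = \<zero>" for x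
  proof (rule formally_real[of x x \<zero> \<zero>])
    have "x \<otimes> x \<oplus> x \<otimes> x = x \<otimes> (x \<oplus> x)"
      using that(1) by (simp add: r_distr)
    then show "x \<otimes> x \<oplus> x \<otimes> x \<oplus> \<zero> \<otimes> \<zero> \<oplus> \<zero> \<otimes> \<zero> = \<zero>"
      using that by simp
  qed (use that in auto)
  have ab: "a \<otimes> b = \<zero>"
  proof (rule two0)
    have "a \<otimes> b \<oplus> a \<otimes> b = a \<otimes> b \<oplus> b \<otimes> a \<oplus> c \<otimes> d \<ominus> d \<otimes> c"
      using car by algebra
    then show "a \<otimes> b \<oplus> a \<otimes> b = \<zero>" using eq(2) by simp
  qed (use car in simp)
  have ac: "a \<otimes> c = \<zero>"
  proof (rule two0)
    have "a \<otimes> c \<oplus> a \<otimes> c = a \<otimes> c \<ominus> b \<otimes> d \<oplus> c \<otimes> a \<oplus> d \<otimes> b"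
      using car by algebra
    then show "a \<otimes> c \<oplus> a \<otimes> c = \<zero>" using eq(3) by simp
  qed (use car in simp)
  have ad: "a \<otimes> d = \<zero>"
  proof (rule two0)
    have "a \<otimes> d \<oplus> a \<otimes> d = a \<otimes> d \<oplus> b \<otimes> c \<ominus> c \<otimes> b \<oplus> d \<otimes> a"
      using car by algebra
    then show "a \<otimes> d \<oplus> a \<otimes> d = \<zero>" using eq(4) by simp
  qed (use car in simp)
  have "a \<otimes> (a \<otimes> a) = a \<otimes> (a \<otimes> a \<ominus> b \<otimes> b \<ominus> c \<otimes> c \<ominus> d \<otimes> d)
      \<oplus> (a \<otimes> b) \<otimes> b \<oplus> (a \<otimes> c) \<otimes> c \<oplus> (a \<otimes> d) \<otimes> d"
    using car by algebra
  then have "a \<otimes> (a \<otimes> a) = \<zero>"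
    using car by (simp add: eq(1) ab ac ad)
  moreover have "(a \<otimes> a) \<otimes> (a \<otimes> a) = a \<otimes> (a \<otimes> (a \<otimes> a))"
    using car by (simp add: m_assoc)
  ultimately have "(a \<otimes> a) \<otimes> (a \<otimes> a) = \<zero>"
    using car by simp
  then have "a \<otimes> a = \<zero>"
    using sq0[of "a \<otimes> a"] car by blast
  then have a: "a = \<zero>"
    using sq0[of a] car by blast
  have "b \<otimes> b \<oplus> c \<otimes> c \<oplus> d \<otimes> d = a \<otimes> a \<ominus> (a \<otimes> a \<ominus> b \<otimes> b \<ominus> c \<otimes> c \<ominus> d \<otimes> d)"
    using car by algebra
  then have sum: "b \<otimes> b \<oplus> c \<otimes> c \<oplus> d \<otimes> d = \<zero>"
    unfolding eq(1) using car by (simp add: a a_minus_def)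
  have "b = \<zero>"
    using formally_real[of b c d \<zero>] sum car by simp
  moreover have "c = \<zero>"
    using formally_real[of c b d \<zero>] sum car by (simp add: a_ac)
  moreover have "d = \<zero>"
    using formally_real[of d b c \<zero>] sum car by (simp add: a_ac)
  ultimately show ?thesis
    by (simp add: * a quaternion_zero)
qed

end

section \<open>Colombeau generalized numbers\<close>

text \<open>The function \<open>x\<close> is \<open>o(\<epsilon>\<^sup>a)\<close> as \<open>\<epsilon> \<rightarrow> 0\<close>.  Moderate and null functions differ only in
  the quantifier on \<open>a\<close>.\<close>

definition small_order :: "real \<Rightarrow> (real \<Rightarrow> 'a::real_normed_field) \<Rightarrow> bool" where
  "small_order a x \<longleftrightarrow> ((\<lambda>e. norm (x e) / e powr a) \<longlongrightarrow> 0) (at 0 within param_interval)"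

lemma moderate_iff: "moderate x \<longleftrightarrow> (\<exists>a. small_order a x)"
  and null_fun_iff: "null_fun x \<longleftrightarrow> (\<forall>a. small_order a x)"
  by (simp_all add: moderate_def null_fun_def small_order_def)

lemma eventually_param_interval: "eventually (\<lambda>e. e \<in> param_interval) (at 0 within param_interval)"
  by (simp add: eventually_at_filter)

lemma small_order_dominated:
  assumes "small_order a y" and "\<And>e. e \<in> param_interval \<Longrightarrow> norm (x e) / e powr b \<le> norm (y e) / e powr a"
  shows "small_order b x"
  unfolding small_order_def
proof (rule tendsto_sandwich[OF _ _ tendsto_const assms(1)[unfolded small_order_def]])
  show "\<forall>\<^sub>F e in at 0 within param_interval. norm (x e) / e powr b \<le> norm (y e) / e powr a"
    by (rule eventually_mono[OF eventually_param_interval]) (rule assms(2))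
qed simp

lemma small_order_norm_le:
  assumes "small_order a y" and "\<And>e. e \<in> param_interval \<Longrightarrow> norm (x e) \<le> norm (y e)"
  shows "small_order a x"
  using assms(1) by (rule small_order_dominated) (simp add: assms(2) divide_right_mono)

lemma small_order_antimono:
  assumes "small_order a x" "b \<le> a"
  shows "small_order b x"
  using assms(1)
proof (rule small_order_dominated)
  fix e :: real assume "e \<in> param_interval"
  then have "e powr a \<le> e powr b" "0 < e powr a"
    using \<open>b \<le> a\<close> by (auto intro: powr_mono')
  then show "norm (x e) / e powr b \<le> norm (x e) / e powr a"
    by (simp add: frac_le)
qed

lemma small_order_add:
  assumes "small_order a x" "small_order a y"
  shows "small_order a (\<lambda>e. x e + y e)"
proof -
  have "((\<lambda>e. norm (x e) / e powr a + norm (y e) / e powr a) \<longlongrightarrow> 0) (at 0 within param_interval)"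
    using tendsto_add[OF assms[unfolded small_order_def]] by simp
  then show ?thesis
    unfolding small_order_def
    by (rule tendsto_sandwich[OF _ _ tendsto_const, rotated 2])
      (simp_all add: add_divide_distrib[symmetric] divide_right_mono norm_triangle_ineq)
qed

lemma small_order_mult:
  assumes "small_order a x" "small_order b y"
  shows "small_order (a + b) (\<lambda>e. x e * y e)"
  using tendsto_mult[OF assms[unfolded small_order_def]]
  by (simp add: small_order_def norm_mult powr_add)

lemma small_order_sqrt:
  assumes "small_order (2 * a) (\<lambda>e. x e * x e)"
  shows "small_order a x"
proof -
  have "((\<lambda>e. sqrt (norm (x e * x e) / e powr (2 * a))) \<longlongrightarrow> sqrt 0) (at 0 within param_interval)"
    using assms unfolding small_order_def by (rule tendsto_real_sqrt)
  moreover have "sqrt (norm (x e * x e) / e powr (2 * a)) = norm (x e) / e powr a" for e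
  proof -
    have "norm (x e * x e) / e powr (2 * a) = (norm (x e) / e powr a)\<^sup>2"
      by (simp add: norm_mult power2_eq_square flip: powr_add)
    then show ?thesis by simp
  qed
  ultimately show ?thesis by (simp add: small_order_def)
qed

text \<open>Two moderate functions are compared at the smaller of their two exponents.\<close>

lemma moderate_add: "\<lbrakk>moderate x; moderate y\<rbrakk> \<Longrightarrow> moderate (\<lambda>e. x e + y e)"
  unfolding moderate_iff by (metis min.cobounded1 min.cobounded2 small_order_add small_order_antimono)

lemma moderate_mult: "\<lbrakk>moderate x; moderate y\<rbrakk> \<Longrightarrow> moderate (\<lambda>e. x e * y e)"
  unfolding moderate_iff using small_order_mult by blast

lemma moderate_norm_le:
  "\<lbrakk>moderate y; \<And>e. e \<in> param_interval \<Longrightarrow> norm (x e) \<le> norm (y e)\<rbrakk> \<Longrightarrow> moderate x"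
  unfolding moderate_iff using small_order_norm_le by blast

lemma null_fun_add: "\<lbrakk>null_fun x; null_fun y\<rbrakk> \<Longrightarrow> null_fun (\<lambda>e. x e + y e)"
  unfolding null_fun_iff by (simp add: small_order_add)

lemma null_fun_norm_le:
  "\<lbrakk>null_fun y; \<And>e. e \<in> param_interval \<Longrightarrow> norm (x e) \<le> norm (y e)\<rbrakk> \<Longrightarrow> null_fun x"
  unfolding null_fun_iff using small_order_norm_le by blast

lemma null_fun_zero: "null_fun (\<lambda>e. 0)"
  by (simp add: null_fun_def)

lemma null_fun_moderate_mult:
  assumes "null_fun x" "moderate y"
  shows "null_fun (\<lambda>e. x e * y e)"
  unfolding null_fun_iff
proof
  fix a
  obtain b where "small_order b y" using assms(2) moderate_iff by blast
  moreover have "small_order (a - b) x" using assms(1) null_fun_iff by blast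
  ultimately show "small_order a (\<lambda>e. x e * y e)"
    using small_order_mult[of "a - b" x b y] by simp
qed

lemma null_fun_sqrt: "null_fun (\<lambda>e. x e * x e) \<Longrightarrow> null_fun x"
  unfolding null_fun_iff using small_order_sqrt by blast

lemma null_fun_imp_moderate: "null_fun x \<Longrightarrow> moderate x"
  by (simp add: null_fun_iff moderate_iff)

lemma moderate_one: "moderate (\<lambda>e. 1)"
proof -
  have "((\<lambda>e. norm (1::'a) / e powr (-1)) \<longlongrightarrow> 0) (at 0 within param_interval)"
  proof (rule tendsto_eq_rhs[OF Lim_transform_eventually])
    show "((\<lambda>e. e) \<longlongrightarrow> 0) (at (0::real) within param_interval)" by (rule tendsto_ident_at)
    show "\<forall>\<^sub>F e in at 0 within param_interval. e = norm (1::'a) / e powr (-1)"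
      by (rule eventually_mono[OF eventually_param_interval]) (simp add: powr_minus_divide)
  qed simp
  then show ?thesis unfolding moderate_def by blast
qed

lemma moderate_restrict [simp]: "moderate (restrict x param_interval) \<longleftrightarrow> moderate x"
  by (auto intro: moderate_norm_le[of x] moderate_norm_le[of "restrict x param_interval"])

lemma null_fun_restrict [simp]: "null_fun (restrict x param_interval) \<longleftrightarrow> null_fun x"
  by (auto intro: null_fun_norm_le[of x] null_fun_norm_le[of "restrict x param_interval"])

lemma moderate_ring_simps:
  "x \<in> carrier moderate_ring \<longleftrightarrow> x \<in> extensional param_interval \<and> moderate x"
  "x \<otimes>\<^bsub>moderate_ring\<^esub> y = (\<lambda>e\<in>param_interval. x e * y e)"
  "x \<oplus>\<^bsub>moderate_ring\<^esub> y = (\<lambda>e\<in>param_interval. x e + y e)"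
  "\<one>\<^bsub>moderate_ring\<^esub> = (\<lambda>e\<in>param_interval. 1)"
  "\<zero>\<^bsub>moderate_ring\<^esub> = (\<lambda>e\<in>param_interval. 0)"
  by (simp_all add: moderate_ring_def)

lemma cring_moderate_ring: "cring (moderate_ring :: (real \<Rightarrow> 'a::real_normed_field) ring)"
    (is "cring ?M")
proof (rule cringI)
  show "abelian_group ?M"
  proof (rule abelian_groupI)
    show "\<zero>\<^bsub>?M\<^esub> \<in> carrier ?M"
      using null_fun_imp_moderate[OF null_fun_zero] by (simp add: moderate_ring_simps)
    fix x assume x: "x \<in> carrier ?M"
    show "\<zero>\<^bsub>?M\<^esub> \<oplus>\<^bsub>?M\<^esub> x = x"
      using x by (auto simp: moderate_ring_simps extensional_def)
    have "moderate (\<lambda>e. - x e)"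
      using x by (auto simp: moderate_ring_simps intro: moderate_norm_le[of x])
    then show "\<exists>y\<in>carrier ?M. y \<oplus>\<^bsub>?M\<^esub> x = \<zero>\<^bsub>?M\<^esub>"
      by (intro bexI[of _ "\<lambda>e\<in>param_interval. - x e"]) (auto simp: moderate_ring_simps)
  qed (auto simp: moderate_ring_simps moderate_add add_ac)
  show "comm_monoid ?M"
  proof (rule comm_monoidI)
    show "\<one>\<^bsub>?M\<^esub> \<otimes>\<^bsub>?M\<^esub> x = x" if "x \<in> carrier ?M" for x
      using that by (auto simp: moderate_ring_simps extensional_def)
  qed (auto simp: moderate_ring_simps moderate_mult moderate_one mult_ac)
qed (auto simp: moderate_ring_simps algebra_simps)

lemma ideal_null_ideal: "ideal null_ideal (moderate_ring :: (real \<Rightarrow> 'a::real_normed_field) ring)"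
    (is "ideal ?N ?M")
proof -
  interpret M: cring ?M by (rule cring_moderate_ring)
  have mult: "x \<otimes>\<^bsub>?M\<^esub> y \<in> ?N" if "x \<in> ?N" "y \<in> carrier ?M" for x y
    using that null_fun_moderate_mult by (auto simp: null_ideal_def moderate_ring_simps)
  have sub: "?N \<subseteq> carrier ?M"
    by (auto simp: null_ideal_def moderate_ring_simps null_fun_imp_moderate)
  have "right_ideal ?N ?M"
    by (rule M.right_idealI[OF sub _ _ mult])
      (auto simp: null_ideal_def moderate_ring_simps null_fun_zero null_fun_add)
  then have "additive_subgroup ?N ?M"
    by (simp add: right_ideal_def)
  moreover have "y \<otimes>\<^bsub>?M\<^esub> x \<in> ?N" if "x \<in> ?N" "y \<in> carrier ?M" for x y
    using mult[OF that] that sub M.m_comm by (metis subsetD)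
  ultimately show ?thesis
    unfolding ideal_def ideal_axioms_def using mult M.ring_axioms by blast
qed

lemma cring_colombeau: "cring (colombeau :: (real \<Rightarrow> 'a::real_normed_field) set ring)"
  unfolding colombeau_def by (rule ideal.quotient_is_cring[OF ideal_null_ideal cring_moderate_ring])

abbreviation colombeau_class :: "(real \<Rightarrow> 'a::real_normed_field) \<Rightarrow> (real \<Rightarrow> 'a) set" where
  "colombeau_class x \<equiv> null_ideal +>\<^bsub>moderate_ring\<^esub> x"

lemma abelian_subgroup_null_ideal: "abelian_subgroup null_ideal moderate_ring"
  using abelian_subgroupI3 ideal.axioms(1)[OF ideal_null_ideal]
    ring.is_abelian_group[OF cring.axioms(1)[OF cring_moderate_ring]] by blast

lemma colombeau_carrier_E:
  assumes "X \<in> carrier colombeau"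
  obtains x where "x \<in> carrier moderate_ring" "X = colombeau_class x"
  using assms by (auto simp: colombeau_def FactRing_def A_RCOSETS_def')

lemma colombeau_mult_class:
  "\<lbrakk>x \<in> carrier moderate_ring; y \<in> carrier moderate_ring\<rbrakk> \<Longrightarrow>
     colombeau_class x \<otimes>\<^bsub>colombeau\<^esub> colombeau_class y = colombeau_class (x \<otimes>\<^bsub>moderate_ring\<^esub> y)"
  by (simp add: colombeau_def FactRing_def ideal.rcoset_mult_add[OF ideal_null_ideal])

lemma colombeau_add_class:
  "\<lbrakk>x \<in> carrier moderate_ring; y \<in> carrier moderate_ring\<rbrakk> \<Longrightarrow>
     colombeau_class x \<oplus>\<^bsub>colombeau\<^esub> colombeau_class y = colombeau_class (x \<oplus>\<^bsub>moderate_ring\<^esub> y)"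
  by (simp add: colombeau_def FactRing_def
      abelian_subgroup.a_rcos_sum[OF abelian_subgroup_null_ideal])

lemma colombeau_class_eq_zero_iff:
  assumes "x \<in> carrier moderate_ring"
  shows "colombeau_class x = \<zero>\<^bsub>colombeau\<^esub> \<longleftrightarrow> null_fun x"
proof -
  have "colombeau_class x = null_ideal \<longleftrightarrow> x \<in> null_ideal"
    using assms abelian_subgroup.a_rcos_self[OF abelian_subgroup_null_ideal assms]
      abelian_subgroup.a_rcos_const[OF abelian_subgroup_null_ideal] by blast
  then show ?thesis
    using assms by (simp add: colombeau_def FactRing_def null_ideal_def moderate_ring_simps)
qed

lemma colombeau_reduced:
  assumes "X \<in> carrier colombeau" "X \<otimes>\<^bsub>colombeau\<^esub> X = \<zero>\<^bsub>colombeau\<^esub>"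
  shows "X = \<zero>\<^bsub>colombeau\<^esub>"
proof -
  interpret M: cring moderate_ring by (rule cring_moderate_ring)
  obtain x where x: "x \<in> carrier moderate_ring" "X = colombeau_class x"
    using assms(1) by (rule colombeau_carrier_E)
  then have "null_fun (x \<otimes>\<^bsub>moderate_ring\<^esub> x)"
    using assms(2) M.m_closed by (simp add: colombeau_mult_class colombeau_class_eq_zero_iff)
  then have "null_fun x"
    by (simp only: moderate_ring_simps null_fun_restrict) (rule null_fun_sqrt)
  with x show ?thesis by (simp add: colombeau_class_eq_zero_iff)
qed

text \<open>A representative of the sum of squares dominates \<open>a\<^sup>2\<close> pointwise, so \<open>a\<^sup>2\<close> and with it \<open>a\<close>
  is null.\<close>

lemma colombeau_real_formally_real:
  assumes "A \<in> carrier colombeau_real" "B \<in> carrier colombeau_real"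
    "C \<in> carrier colombeau_real" "D \<in> carrier colombeau_real"
    and sum: "A \<otimes>\<^bsub>colombeau\<^esub> A \<oplus>\<^bsub>colombeau\<^esub> B \<otimes>\<^bsub>colombeau\<^esub> B \<oplus>\<^bsub>colombeau\<^esub> C \<otimes>\<^bsub>colombeau\<^esub> C
      \<oplus>\<^bsub>colombeau\<^esub> D \<otimes>\<^bsub>colombeau\<^esub> D = \<zero>\<^bsub>colombeau\<^esub>"
  shows "A = \<zero>\<^bsub>colombeau\<^esub>"
proof -
  interpret M: cring "moderate_ring :: (real \<Rightarrow> real) ring" by (rule cring_moderate_ring)
  obtain a where a: "a \<in> carrier moderate_ring" "A = colombeau_class a"
    using assms(1) by (rule colombeau_carrier_E)
  obtain b where b: "b \<in> carrier moderate_ring" "B = colombeau_class b"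
    using assms(2) by (rule colombeau_carrier_E)
  obtain c where c: "c \<in> carrier moderate_ring" "C = colombeau_class c"
    using assms(3) by (rule colombeau_carrier_E)
  obtain d where d: "d \<in> carrier moderate_ring" "D = colombeau_class d"
    using assms(4) by (rule colombeau_carrier_E)
  let ?s = "a \<otimes>\<^bsub>moderate_ring\<^esub> a \<oplus>\<^bsub>moderate_ring\<^esub> b \<otimes>\<^bsub>moderate_ring\<^esub> b
    \<oplus>\<^bsub>moderate_ring\<^esub> c \<otimes>\<^bsub>moderate_ring\<^esub> c \<oplus>\<^bsub>moderate_ring\<^esub> d \<otimes>\<^bsub>moderate_ring\<^esub> d"
  have "colombeau_class ?s = \<zero>\<^bsub>colombeau\<^esub>"
    using sum a b c d by (simp add: colombeau_mult_class colombeau_add_class)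
  then have "null_fun ?s"
    using a b c d by (simp add: colombeau_class_eq_zero_iff)
  then have "null_fun (\<lambda>e. a e * a e)"
    by (rule null_fun_norm_le) (simp add: moderate_ring_simps)
  then have "null_fun a" by (rule null_fun_sqrt)
  with a show ?thesis by (simp add: colombeau_class_eq_zero_iff)
qed

theorem mainTheorem2:
  shows "Z_r colombeau_real = {\<zero>\<^bsub>colombeau_real\<^esub>} \<and>
         Z_r colombeau_complex = {\<zero>\<^bsub>colombeau_complex\<^esub>} \<and>
         Z_r colombeau_quaternions = {\<zero>\<^bsub>colombeau_quaternions\<^esub>} \<and>
         von_neumann_regular (Q_max colombeau_real) \<and>
         von_neumann_regular (Q_max colombeau_complex) \<and>
         von_neumann_regular (Q_mr colombeau_quaternions)"
proof -
  interpret R: cring colombeau_real by (rule cring_colombeau)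
  interpret C: cring colombeau_complex by (rule cring_colombeau)
  interpret H: ring colombeau_quaternions by (rule R.ring_quaternion_ring)
  have R: "Z_r colombeau_real = {\<zero>\<^bsub>colombeau_real\<^esub>}"
    by (rule R.Z_r_reduced) (rule colombeau_reduced)
  have C: "Z_r colombeau_complex = {\<zero>\<^bsub>colombeau_complex\<^esub>}"
    by (rule C.Z_r_reduced) (rule colombeau_reduced)
  have H: "Z_r colombeau_quaternions = {\<zero>\<^bsub>colombeau_quaternions\<^esub>}"
    by (rule H.Z_r_reduced, rule R.quaternion_reduced[OF colombeau_real_formally_real])
  show ?thesis
    using R C H R.von_neumann_regular_Q_mr C.von_neumann_regular_Q_mr H.von_neumann_regular_Q_mr
    by simp
qed

end
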